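(* Let $E$ be a matrix base ordered space with matrix convex set $K$ and base function $f_1$, and let $\|\cdot\|_n$ be the expressions defined on $M_n(E)$ as in the context. Then the $\|\cdot\|_n$ are matrix norms with respect to which $E$ is an operator space and a matrix ordered matrix normed $*$-vector space, and $K$ lies in the positive part of the matrix unit ball of $E$. Also, $f_1$ is (completely) contractive on $E$, and $\| x \|_n = \| f_1^{(n)}(x) \|$ for $x \in M_n(E)_+$. Indeed $E$ satisfies all of the conditions to be a nc base norm space except possibly for $M_n(E)_+$ and $K_n$ being closed in the norm topology for $n \in \mathbb{N}$.
   Context: $\mathbb{F}=\mathbb{R}$ or $\mathbb{C}$. A matrix ordered space is a $*$-vector space $E$ with proper cones $M_n(E)_+ \subset M_n(E)_{\rm sa}$ such that $\alpha^* M_n(E)_+ \alpha \subset M_m(E)_+$ for all $\alpha \in M_{n,m}(\mathbb{F})$. A matrix convex set $K=(K_n)$, $K_n\subset M_n(E)$, is closed under direct sums and under compressions $x\mapsto a^*xa$ with $a^*a=I$. $E$ (with such $K$) is a matrix base ordered space if: (a) there is a strictly positive selfadjoint scalar functional $f_1$ on $E$ (the base function) with $K_n = M_n(E)_+ \cap \{x \in M_n(E): f_1^{(n)}(x) = I_n\}$; (b) for every $n$ and $x \in M_n(E)_{\rm sa}$ there exist $t>0$ and $k \in K_n$ with $x \le tk$; (c) if $x \in M_n(E)_{\rm sa}$ and for every $\epsilon>0$ one can write $x=y-z$ with $y,z\in M_n(E)_+$ and $\|f_1^{(n)}(y)\|,\|f_1^{(n)}(z)\|<\epsilon$, then $x=0$.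 The norms are defined by $\|x\|_n = \inf\{\|f_1^{(n)}(y+z)\| : x=y-z,\ y,z\in M_n(E)_+\}$ for $x\in M_n(E)_{\rm sa}$, and for general $x\in M_n(E)$ by $\|x\|_n = \left\|\begin{bmatrix} 0 & x\\ x^* & 0\end{bmatrix}\right\|_{2n}$. A matrix ordered matrix normed $*$-vector space is a matrix ordered space with a norm at each matrix level, closed matrix cones, and $\|x^*\|_n=\|x\|_n$. A nc base norm space is such a space $E$ which is also an operator space, with a matrix convex set $K$ such that: 1) $K_n \subset {\rm Ball}(M_n(E))_+$; 2) each $K_n$ is closed; 3) for every $t>1$ every element of ${\rm Ball}(M_n(E))_{\rm sa}$ has the form $c_1x_1c_1 - c_2x_2c_2$ with $c_i$ positive matrices, $c_1^2+c_2^2\le tI$, $x_i\in K_n$; 4) $K_n = M_n(E)_+\cap\{x: f_1^{(n)}(x)=I_n\}$ for a fixed positive (selfadjoint in the real case) scalar functional $f_1$.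
   Formalization: Closedness of the cones M_n(E)_+, part of the definition of a matrix ordered matrix normed *-vector space, is not asserted (nor is that of K_n): it can fail, as the last sentence of the statement itself allows; all other properties are stated. *)

theory Defs
  imports Complex_Main
begin

text \<open>A real normed field carrying a conjugation with x * conj x = norm x squared.
  By Mazur's theorem such a field is (isometric to) R or C, and the axiom forces the
  conjugation to be the identity on R and complex conjugation on C.  Both are instances below,
  so the main theorem covers F = R and F = C simultaneously.\<close>

class rcl_field = real_normed_field +
  fixes sconj :: "'a \<Rightarrow> 'a"
  assumes sconj_zero: "sconj 0 = 0"
    and sconj_mult: "x * sconj x = ((norm x)\<^sup>2) *\<^sub>R 1"

instantiation real :: rcl_field
begin
definition sconj_real :: "real \<Rightarrow> real" where "sconj_real x = x"
instance by standard (auto simp: sconj_real_def power2_eq_square)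
end

instantiation complex :: rcl_field
begin
definition sconj_complex :: "complex \<Rightarrow> complex" where "sconj_complex z = cnj z"
instance by standard (auto simp: sconj_complex_def complex_norm_square[symmetric] scaleR_conv_of_real)
end

definition mats :: "nat \<Rightarrow> nat \<Rightarrow> (nat \<Rightarrow> nat \<Rightarrow> 'a::zero) set" where
  "mats n m = {x. \<forall>i j. \<not> (i < n \<and> j < m) \<longrightarrow> x i j = 0}"

definition mzero :: "nat \<Rightarrow> nat \<Rightarrow> 'a::zero" where
  "mzero = (\<lambda>i j. 0)"

definition madd :: "(nat \<Rightarrow> nat \<Rightarrow> 'a::plus) \<Rightarrow> (nat \<Rightarrow> nat \<Rightarrow> 'a) \<Rightarrow> nat \<Rightarrow> nat \<Rightarrow> 'a" where
  "madd x y = (\<lambda>i j. x i j + y i j)"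

definition mneg :: "(nat \<Rightarrow> nat \<Rightarrow> 'a::uminus) \<Rightarrow> nat \<Rightarrow> nat \<Rightarrow> 'a" where
  "mneg x = (\<lambda>i j. - x i j)"

definition msub :: "(nat \<Rightarrow> nat \<Rightarrow> 'a::minus) \<Rightarrow> (nat \<Rightarrow> nat \<Rightarrow> 'a) \<Rightarrow> nat \<Rightarrow> nat \<Rightarrow> 'a" where
  "msub x y = (\<lambda>i j. x i j - y i j)"

definition idm :: "nat \<Rightarrow> nat \<Rightarrow> nat \<Rightarrow> 'f::{zero,one}" where
  "idm n = (\<lambda>i j. if i = j \<and> i < n then 1 else 0)"

definition ctrans :: "(nat \<Rightarrow> nat \<Rightarrow> 'f::rcl_field) \<Rightarrow> nat \<Rightarrow> nat \<Rightarrow> 'f" where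
  "ctrans a = (\<lambda>i j. sconj (a j i))"

definition smul :: "nat \<Rightarrow> nat \<Rightarrow> nat \<Rightarrow> (nat \<Rightarrow> nat \<Rightarrow> 'f::comm_ring_1)
    \<Rightarrow> (nat \<Rightarrow> nat \<Rightarrow> 'f) \<Rightarrow> nat \<Rightarrow> nat \<Rightarrow> 'f" where
  "smul m n p a b = (\<lambda>i j. if i < m \<and> j < p then (\<Sum>k<n. a i k * b k j) else 0)"

definition vnorm :: "nat \<Rightarrow> (nat \<Rightarrow> 'f::real_normed_field) \<Rightarrow> real" where
  "vnorm n v = sqrt (\<Sum>i<n. (norm (v i))\<^sup>2)"

definition mnorm :: "nat \<Rightarrow> nat \<Rightarrow> (nat \<Rightarrow> nat \<Rightarrow> 'f::real_normed_field) \<Rightarrow> real" where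
  "mnorm n m A = Sup {vnorm n (\<lambda>i. \<Sum>j<m. A i j * v j) | v. vnorm m v \<le> 1}"

definition psd :: "nat \<Rightarrow> (nat \<Rightarrow> nat \<Rightarrow> 'f::rcl_field) \<Rightarrow> bool" where
  "psd n A \<longleftrightarrow> A \<in> mats n n \<and> ctrans A = A \<and>
     (\<forall>v. \<exists>r\<ge>0. (\<Sum>i<n. \<Sum>j<n. sconj (v i) * A i j * v j) = of_real r)"

definition mstar :: "('e \<Rightarrow> 'e) \<Rightarrow> (nat \<Rightarrow> nat \<Rightarrow> 'e) \<Rightarrow> nat \<Rightarrow> nat \<Rightarrow> 'e" where
  "mstar st x = (\<lambda>i j. st (x j i))"

definition msa :: "('e \<Rightarrow> 'e) \<Rightarrow> nat \<Rightarrow> (nat \<Rightarrow> nat \<Rightarrow> 'e::zero) set" where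
  "msa st n = {x \<in> mats n n. mstar st x = x}"

definition mscale :: "('f \<Rightarrow> 'e \<Rightarrow> 'e) \<Rightarrow> 'f \<Rightarrow> (nat \<Rightarrow> nat \<Rightarrow> 'e) \<Rightarrow> nat \<Rightarrow> nat \<Rightarrow> 'e" where
  "mscale scale c x = (\<lambda>i j. scale c (x i j))"

definition mmul :: "('f::comm_ring_1 \<Rightarrow> 'e::ab_group_add \<Rightarrow> 'e) \<Rightarrow> nat \<Rightarrow> nat \<Rightarrow> nat
    \<Rightarrow> (nat \<Rightarrow> nat \<Rightarrow> 'f) \<Rightarrow> (nat \<Rightarrow> nat \<Rightarrow> 'e) \<Rightarrow> (nat \<Rightarrow> nat \<Rightarrow> 'f) \<Rightarrow> nat \<Rightarrow> nat \<Rightarrow> 'e" where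
  "mmul scale m n p a x b =
     (\<lambda>i j. if i < m \<and> j < p then (\<Sum>k<n. \<Sum>l<n. scale (a i k * b l j) (x k l)) else 0)"

definition dsum :: "nat \<Rightarrow> (nat \<Rightarrow> nat \<Rightarrow> 'a::zero) \<Rightarrow> (nat \<Rightarrow> nat \<Rightarrow> 'a) \<Rightarrow> nat \<Rightarrow> nat \<Rightarrow> 'a" where
  "dsum n x y = (\<lambda>i j. if i < n \<and> j < n then x i j
                        else if n \<le> i \<and> n \<le> j then y (i - n) (j - n) else 0)"

definition fmap :: "('e \<Rightarrow> 'f) \<Rightarrow> (nat \<Rightarrow> nat \<Rightarrow> 'e) \<Rightarrow> nat \<Rightarrow> nat \<Rightarrow> 'f" where
  "fmap f x = (\<lambda>i j. f (x i j))"

definition e11 :: "'e::zero \<Rightarrow> nat \<Rightarrow> nat \<Rightarrow> 'e" where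
  "e11 x = (\<lambda>i j. if i = 0 \<and> j = 0 then x else 0)"

text \<open>scale: the F-vector space structure of E; st: the involution; C n = M_n(E)_+.\<close>
definition star_vector_space :: "('f::rcl_field \<Rightarrow> 'e::ab_group_add \<Rightarrow> 'e) \<Rightarrow> ('e \<Rightarrow> 'e) \<Rightarrow> bool" where
  "star_vector_space scale st \<longleftrightarrow> vector_space scale \<and>
     (\<forall>x y. st (x + y) = st x + st y) \<and> (\<forall>c x. st (scale c x) = scale (sconj c) (st x)) \<and>
     (\<forall>x. st (st x) = x)"

definition matrix_ordered :: "('f::rcl_field \<Rightarrow> 'e::ab_group_add \<Rightarrow> 'e) \<Rightarrow> ('e \<Rightarrow> 'e)
    \<Rightarrow> (nat \<Rightarrow> (nat \<Rightarrow> nat \<Rightarrow> 'e) set) \<Rightarrow> bool" where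
  "matrix_ordered scale st C \<longleftrightarrow> star_vector_space scale st \<and>
     (\<forall>n>0. C n \<subseteq> msa st n \<and> mzero \<in> C n \<and>
        (\<forall>x\<in>C n. \<forall>y\<in>C n. madd x y \<in> C n) \<and>
        (\<forall>x\<in>C n. \<forall>t::real. t \<ge> 0 \<longrightarrow> mscale scale (of_real t) x \<in> C n) \<and>
        (\<forall>x. x \<in> C n \<and> mneg x \<in> C n \<longrightarrow> x = mzero)) \<and>
     (\<forall>n>0. \<forall>m>0. \<forall>a\<in>mats n m. \<forall>x\<in>C n. mmul scale m n m (ctrans a) x a \<in> C m)"

definition matrix_convex :: "('f::rcl_field \<Rightarrow> 'e::ab_group_add \<Rightarrow> 'e)
    \<Rightarrow> (nat \<Rightarrow> (nat \<Rightarrow> nat \<Rightarrow> 'e) set) \<Rightarrow> bool" where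
  "matrix_convex scale K \<longleftrightarrow>
     (\<forall>n>0. K n \<subseteq> mats n n) \<and>
     (\<forall>n>0. \<forall>m>0. \<forall>x\<in>K n. \<forall>y\<in>K m. dsum n x y \<in> K (n + m)) \<and>
     (\<forall>n>0. \<forall>m>0. \<forall>a\<in>mats n m. smul m n m (ctrans a) a = idm m \<longrightarrow>
         (\<forall>x\<in>K n. mmul scale m n m (ctrans a) x a \<in> K m))"

definition strictly_pos_sa_functional :: "('f::rcl_field \<Rightarrow> 'e::ab_group_add \<Rightarrow> 'e) \<Rightarrow> ('e \<Rightarrow> 'e)
    \<Rightarrow> (nat \<Rightarrow> (nat \<Rightarrow> nat \<Rightarrow> 'e) set) \<Rightarrow> ('e \<Rightarrow> 'f) \<Rightarrow> bool" where
  "strictly_pos_sa_functional scale st C f \<longleftrightarrow>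
     (\<forall>x y. f (x + y) = f x + f y) \<and> (\<forall>c x. f (scale c x) = c * f x) \<and>
     (\<forall>x. f (st x) = sconj (f x)) \<and>
     (\<forall>x. e11 x \<in> C 1 \<and> x \<noteq> 0 \<longrightarrow> (\<exists>r>0. f x = of_real r))"

definition matrix_base_ordered :: "('f::rcl_field \<Rightarrow> 'e::ab_group_add \<Rightarrow> 'e) \<Rightarrow> ('e \<Rightarrow> 'e)
    \<Rightarrow> (nat \<Rightarrow> (nat \<Rightarrow> nat \<Rightarrow> 'e) set) \<Rightarrow> (nat \<Rightarrow> (nat \<Rightarrow> nat \<Rightarrow> 'e) set) \<Rightarrow> ('e \<Rightarrow> 'f) \<Rightarrow> bool" where
  "matrix_base_ordered scale st C K f1 \<longleftrightarrow>
     matrix_ordered scale st C \<and> matrix_convex scale K \<and>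
     strictly_pos_sa_functional scale st C f1 \<and>
     (\<forall>n>0. K n = {x \<in> C n. fmap f1 x = idm n}) \<and>
     (\<forall>n>0. \<forall>x\<in>msa st n. \<exists>t::real>0. \<exists>k\<in>K n. msub (mscale scale (of_real t) k) x \<in> C n) \<and>
     (\<forall>n>0. \<forall>x\<in>msa st n.
        (\<forall>\<epsilon>>0. \<exists>y\<in>C n. \<exists>z\<in>C n. x = msub y z \<and>
            mnorm n n (fmap f1 y) < \<epsilon> \<and> mnorm n n (fmap f1 z) < \<epsilon>) \<longrightarrow> x = mzero)"

definition bnorm_sa :: "('f::rcl_field \<Rightarrow> 'e::ab_group_add \<Rightarrow> 'e) \<Rightarrow> ('e \<Rightarrow> 'f)
    \<Rightarrow> (nat \<Rightarrow> (nat \<Rightarrow> nat \<Rightarrow> 'e) set) \<Rightarrow> nat \<Rightarrow> (nat \<Rightarrow> nat \<Rightarrow> 'e) \<Rightarrow> real" where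
  "bnorm_sa scale f1 C n x =
     Inf {mnorm n n (fmap f1 (madd y z)) | y z. y \<in> C n \<and> z \<in> C n \<and> x = msub y z}"

definition offdiag :: "('e::zero \<Rightarrow> 'e) \<Rightarrow> nat \<Rightarrow> (nat \<Rightarrow> nat \<Rightarrow> 'e) \<Rightarrow> nat \<Rightarrow> nat \<Rightarrow> 'e" where
  "offdiag st n x = (\<lambda>i j. if i < n \<and> n \<le> j \<and> j < 2 * n then x i (j - n)
                           else if n \<le> i \<and> i < 2 * n \<and> j < n then st (x j (i - n)) else 0)"

definition bnorm :: "('f::rcl_field \<Rightarrow> 'e::ab_group_add \<Rightarrow> 'e) \<Rightarrow> ('e \<Rightarrow> 'e) \<Rightarrow> ('e \<Rightarrow> 'f)
    \<Rightarrow> (nat \<Rightarrow> (nat \<Rightarrow> nat \<Rightarrow> 'e) set) \<Rightarrow> nat \<Rightarrow> (nat \<Rightarrow> nat \<Rightarrow> 'e) \<Rightarrow> real" where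
  "bnorm scale st f1 C n x =
     (if mstar st x = x then bnorm_sa scale f1 C n x
      else bnorm_sa scale f1 C (2 * n) (offdiag st n x))"

end

theory Submission
  imports Defs
begin

text \<open>For \<open>A\<close> hermitian, \<open>mnorm A \<le> r\<close> follows from the quadratic form bound
  \<open>\<bar>v\<^sup>* A v\<bar> \<le> r \<bar>v\<bar>\<^sup>2\<close> by polarization, so the norm of a selfadjoint \<open>x\<close> is the infimum of those \<open>r\<close>
  for which \<open>x = y - z\<close> with \<open>y, z \<ge> 0\<close> and \<open>f\<^sub>1(y + z) \<le> r I\<close>. Conjugating such decompositions gives
  \<open>\<parallel>a\<^sup>* x a + b\<^sup>* y b\<parallel> \<le> c max \<parallel>x\<parallel> \<parallel>y\<parallel>\<close> whenever \<open>a\<^sup>* a + b\<^sup>* b \<le> c I\<close>, and every operator space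
  axiom is an instance of this inequality applied to the selfadjoint matrices \<open>[0 x; x\<^sup>* 0]\<close>. For the
  unit ball decomposition, \<open>y\<close> and \<open>z\<close> are perturbed by a multiple of an element of \<open>K\<close>, which makes
  \<open>f\<^sub>1(y)\<close> positive definite; then \<open>y = c k c\<close> with \<open>c = f\<^sub>1(y)\<^sup>1\<^sup>/\<^sup>2\<close> and \<open>k = c\<^sup>-\<^sup>1 y c\<^sup>-\<^sup>1\<close> in \<open>K\<close>.\<close>

section \<open>Scalars and matrix norms\<close>

text \<open>The scalar class treats both fields at once but supplies neither coordinates nor
  completeness. Both are recovered from the real part of a scalar and from an imaginary unit
  obtained by normalizing any skew scalar; convergence questions then concern real sequences only.
  This is what allows the square root of a positive definite matrix to be built as a limit of
  iterates, without diagonalization. Estimates pass through quadratic forms because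
  \<open>f1\<close> is assumed positive only on \<open>E\<close> itself: a vector v is exactly a
  compression from level n to level 1, so positivity at higher levels is first seen on forms. The
  infimum defining the norm need not be attained, so estimates carry a slack. In the unit ball
  decomposition a second slack enters: the value of \<open>f1\<close> at y may be singular and has
  no inverse square root until y is perturbed. Both are absorbed by t > 1.\<close>

lemma norm_sconj [simp]: "norm (sconj (x::'f::rcl_field)) = norm x"
proof (cases "x = 0")
  case False
  have "norm x * norm (sconj x) = norm x * norm x"
    by (metis sconj_mult norm_mult norm_scaleR norm_one mult.right_neutral abs_power2 abs_norm_cancel
        power2_eq_square abs_mult)
  with False show ?thesis by simp
qed (simp add: sconj_zero)

text \<open>The class axiom determines the conjugation away from 0, and the formula makes
  multiplicativity follow from that of the norm, without any appeal to additivity.\<close>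

lemma sconj_eq: "sconj (x::'f::rcl_field) = of_real ((norm x)\<^sup>2) / x"
proof (cases "x = 0")
  case False
  then show ?thesis using sconj_mult[of x] by (simp add: field_simps of_real_def)
qed (simp add: sconj_zero)

lemma sconj_times: "sconj (x * y :: 'f::rcl_field) = sconj x * sconj y"
  by (simp add: sconj_eq norm_mult power_mult_distrib)

lemma sconj_sconj [simp]: "sconj (sconj (x::'f::rcl_field)) = x"
proof (cases "x = 0")
  case False
  then have "sconj x \<noteq> 0" by (metis norm_sconj norm_eq_zero)
  moreover have "sconj x * sconj (sconj x) = sconj x * x"
    using sconj_mult[of "sconj x"] sconj_mult[of x] by (simp add: mult.commute)
  ultimately show ?thesis by simp
qed (simp add: sconj_zero)

lemma sconj_of_real [simp]: "sconj (of_real r :: 'f::rcl_field) = of_real r"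
  by (cases "r = 0") (simp_all add: sconj_zero sconj_eq power2_eq_square flip: of_real_mult of_real_divide)

lemma sconj_one [simp]: "sconj (1 :: 'f::rcl_field) = 1"
  using sconj_of_real[of 1] by simp

lemma sconj_mult_self: "sconj x * (x :: 'f::rcl_field) = of_real ((norm x)\<^sup>2)"
  using sconj_mult[of x] by (simp add: of_real_def mult.commute)

text \<open>With \<open>sconj\<close> additive this is the real part, since \<open>\<bar>x + 1\<bar>\<^sup>2 = \<bar>x\<bar>\<^sup>2 + (x + sconj x) + 1\<close>.\<close>
definition re_part :: "'f::rcl_field \<Rightarrow> real" where
  "re_part x = ((norm (x + 1))\<^sup>2 - (norm x)\<^sup>2 - 1) / 2"

section \<open>Euclidean norms, operator norms and sesquilinear forms\<close>

definition vsq :: "nat \<Rightarrow> (nat \<Rightarrow> 'f::real_normed_field) \<Rightarrow> real" where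
  "vsq n v = (\<Sum>i<n. (norm (v i))\<^sup>2)"

definition mv :: "nat \<Rightarrow> (nat \<Rightarrow> nat \<Rightarrow> 'f::real_normed_field) \<Rightarrow> (nat \<Rightarrow> 'f) \<Rightarrow> nat \<Rightarrow> 'f" where
  "mv m A v = (\<lambda>i. \<Sum>j<m. A i j * v j)"

definition sform :: "nat \<Rightarrow> nat \<Rightarrow> (nat \<Rightarrow> 'f::rcl_field) \<Rightarrow> (nat \<Rightarrow> nat \<Rightarrow> 'f) \<Rightarrow> (nat \<Rightarrow> 'f) \<Rightarrow> 'f" where
  "sform n m w A v = (\<Sum>i<n. \<Sum>j<m. sconj (w i) * A i j * v j)"

lemma vsq_nonneg [simp]: "0 \<le> vsq n v"
  by (simp add: vsq_def sum_nonneg)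

lemma vsq_zero_iff: "vsq n v = 0 \<longleftrightarrow> (\<forall>i<n. v i = 0)"
  by (auto simp: vsq_def sum_nonneg_eq_0_iff)

lemma vsq_scale: "vsq n (\<lambda>i. c * v i) = (norm c)\<^sup>2 * vsq n v"
  by (simp add: vsq_def norm_mult power_mult_distrib sum_distrib_left)

lemma mv_scale: "mv m A (\<lambda>j. c * v j) = (\<lambda>i. c * mv m A v i)"
  by (simp add: mv_def sum_distrib_left algebra_simps)

lemma vnorm_mv: "vnorm n (\<lambda>i. \<Sum>j<m. A i j * v j) = sqrt (vsq n (mv m A v))"
  by (simp add: vnorm_def vsq_def mv_def)

lemma vnorm_le_one: "vnorm m v \<le> 1 \<longleftrightarrow> vsq m v \<le> 1"
  by (simp add: vnorm_def vsq_def)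

lemma mnorm_alt: "mnorm n m A = Sup {sqrt (vsq n (mv m A v)) | v. vsq m v \<le> 1}"
  by (simp add: mnorm_def vnorm_mv vnorm_le_one)

text \<open>A real supremum carries information only for a bounded set. The crude bound by row sums
  of entry norms suffices here, since the entries of a vector in the unit ball have norm at most
  1.\<close>

lemma mnorm_bdd: "bdd_above {sqrt (vsq n (mv m A v)) | v. vsq m v \<le> 1}"
proof (rule bdd_aboveI)
  fix s assume "s \<in> {sqrt (vsq n (mv m A v)) | v. vsq m v \<le> 1}"
  then obtain v where s: "s = sqrt (vsq n (mv m A v))" and v: "vsq m v \<le> 1" by auto
  have vj: "norm (v j) \<le> 1" if "j < m" for j
  proof -
    have "(norm (v j))\<^sup>2 \<le> vsq m v"
      unfolding vsq_def using that by (intro member_le_sum) auto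
    with v have "(norm (v j))\<^sup>2 \<le> 1" by simp
    then show ?thesis by (simp add: abs_square_le_1)
  qed
  have "norm (mv m A v i) \<le> (\<Sum>j<m. norm (A i j))" for i
    unfolding mv_def
    by (rule sum_norm_le) (use vj in \<open>auto simp: norm_mult intro!: mult_left_le\<close>)
  then have "vsq n (mv m A v) \<le> (\<Sum>i<n. (\<Sum>j<m. norm (A i j))\<^sup>2)"
    unfolding vsq_def by (intro sum_mono power_mono) auto
  then show "s \<le> sqrt (\<Sum>i<n. (\<Sum>j<m. norm (A i j))\<^sup>2)" by (simp add: s)
qed

lemma mnorm_upper: "vsq m v \<le> 1 \<Longrightarrow> sqrt (vsq n (mv m A v)) \<le> mnorm n m A"
  unfolding mnorm_alt by (rule cSup_upper) (auto intro: mnorm_bdd)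

lemma mnorm_nonneg [simp]: "0 \<le> mnorm n m A"
  using mnorm_upper[of m "\<lambda>_. 0" n A] by (simp add: vsq_def mv_def)

lemma vsq_mv_le: "vsq n (mv m A v) \<le> (mnorm n m A)\<^sup>2 * vsq m v"
proof (cases "vsq m v = 0")
  case True
  then have "vsq n (mv m A v) = 0" by (auto simp: vsq_zero_iff mv_def)
  with True show ?thesis by simp
next
  case False
  \<comment> \<open>Homogeneity: the supremum only speaks about the unit ball, so v is normalized to
    w.\<close>
  define s where "s = sqrt (vsq m v)"
  have s: "s > 0" "s\<^sup>2 = vsq m v" using False by (auto simp: s_def less_le)
  define w where "w = (\<lambda>j. of_real (1/s) * v j)"
  have "vsq m w = 1" unfolding w_def vsq_scale using s False
    by (simp add: norm_divide power_divide)
  then have "sqrt (vsq n (mv m A w)) \<le> mnorm n m A" by (intro mnorm_upper) simp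
  then have "(sqrt (vsq n (mv m A w)))\<^sup>2 \<le> (mnorm n m A)\<^sup>2" by (intro power_mono) auto
  then have "vsq n (mv m A w) \<le> (mnorm n m A)\<^sup>2" by simp
  moreover have "vsq n (mv m A w) = vsq n (mv m A v) / s\<^sup>2"
    unfolding w_def mv_scale vsq_scale by (simp add: norm_divide power_divide)
  ultimately show ?thesis using s False vsq_nonneg[of m v] by (simp add: field_simps less_le)
qed

lemma mnorm_le:
  assumes "r \<ge> 0" "\<And>v. vsq n (mv m A v) \<le> r\<^sup>2 * vsq m v"
  shows "mnorm n m A \<le> r"
  unfolding mnorm_alt
proof (rule cSup_least)
  show "{sqrt (vsq n (mv m A v)) |v. vsq m v \<le> 1} \<noteq> {}"
    by (auto intro!: exI[of _ "\<lambda>_. 0"] simp: vsq_def)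
next
  fix s assume "s \<in> {sqrt (vsq n (mv m A v)) | v. vsq m v \<le> 1}"
  then obtain v where s: "s = sqrt (vsq n (mv m A v))" and v: "vsq m v \<le> 1" by auto
  have "vsq n (mv m A v) \<le> r\<^sup>2" using assms(2)[of v] v
    by (meson mult_left_le order_trans zero_le_power2)
  then show "s \<le> r" using assms(1) by (simp add: s real_le_lsqrt)
qed

text \<open>Column j is the image of the j-th standard basis vector, which has norm 1.\<close>

lemma norm_entry_le_mnorm:
  assumes "i < n" "j < m"
  shows "norm (A i j) \<le> mnorm n m A"
proof -
  define v where "v = (\<lambda>k. if k = j then 1 else (0::'a))"
  have *: "mv m A v = (\<lambda>i. A i j)"
    using assms by (auto simp: mv_def v_def if_distrib[of "\<lambda>x. _ * x"] cong: if_cong)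
  have "vsq m v = 1" using assms by (simp add: vsq_def v_def if_distrib[of norm] if_distrib[of "\<lambda>x. x ^ _"] cong: if_cong)
  then have "vsq n (\<lambda>i. A i j) \<le> (mnorm n m A)\<^sup>2" using vsq_mv_le[of n m A v] * by simp
  moreover have "(norm (A i j))\<^sup>2 \<le> vsq n (\<lambda>i. A i j)"
    unfolding vsq_def using assms by (intro member_le_sum) auto
  ultimately show ?thesis
    by (meson mnorm_nonneg order_trans power2_le_imp_le)
qed

lemma sform_mv: "sform n m w A v = (\<Sum>i<n. sconj (w i) * mv m A v i)"
  by (simp add: sform_def mv_def sum_distrib_left mult.assoc)

lemma ctrans_ctrans [simp]: "ctrans (ctrans A) = A"
  by (simp add: ctrans_def)

lemma smul_mats [simp]: "smul m n p a b \<in> mats m p"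
  by (simp add: smul_def mats_def)

lemma mv_smul: "i < m \<Longrightarrow> mv p (smul m n p a b) v i = mv n a (mv p b v) (i::nat)"
proof -
  assume "i < m"
  then have "mv p (smul m n p a b) v i = (\<Sum>j<p. \<Sum>k<n. a i k * b k j * v j)"
    by (simp add: mv_def smul_def sum_distrib_right)
  also have "\<dots> = (\<Sum>k<n. \<Sum>j<p. a i k * b k j * v j)" by (rule sum.swap)
  finally show ?thesis by (simp add: mv_def sum_distrib_left mult.assoc)
qed

lemma vsq_cong: "(\<And>i. i < n \<Longrightarrow> v i = w i) \<Longrightarrow> vsq n v = vsq n w"
  by (simp add: vsq_def)

lemma mnorm_cong: "(\<And>i j. i < n \<Longrightarrow> j < m \<Longrightarrow> A i j = B i j) \<Longrightarrow> mnorm n m A = mnorm n m B"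
  unfolding mnorm_alt by (simp add: vsq_def mv_def)

lemma mats_zero: "x \<in> mats n m \<Longrightarrow> n \<le> i \<or> m \<le> j \<Longrightarrow> x i j = 0"
  by (auto simp: mats_def)

lemma mnorm_zero_imp:
  assumes "a \<in> mats m n" "mnorm m n a = 0"
  shows "a = mzero"
proof (intro ext)
  fix i j
  show "a i j = mzero i j"
  proof (cases "i < m \<and> j < n")
    case True
    then show ?thesis
      using norm_entry_le_mnorm[where i=i and j=j and n=m and m=n and A=a] assms(2) by (simp add: mzero_def)
  qed (use assms in \<open>auto simp: mats_def mzero_def\<close>)
qed

lemma sum_lessThan_add:
  fixes g :: "nat \<Rightarrow> 'a::comm_monoid_add"
  shows "(\<Sum>k<n+m. g k) = (\<Sum>k<n. g k) + (\<Sum>k<m. g (n + k))"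
  by (induction m) (simp_all add: add.assoc)

lemma sum_lessThan_double:
  fixes g :: "nat \<Rightarrow> 'a::comm_monoid_add"
  shows "(\<Sum>k<2*n. g k) = (\<Sum>k<n. g k) + (\<Sum>k<n. g (n + k))"
  using sum_lessThan_add[of g n n] by (simp add: mult_2)

lemma vsq_double: "vsq (2*n) v = vsq n v + vsq n (\<lambda>k. v (n + k))"
  by (simp add: vsq_def sum_lessThan_double)

lemma sum_swap_pairs:
  "(\<Sum>k\<in>A. \<Sum>l\<in>A. \<Sum>p\<in>B. \<Sum>q\<in>B. g k l p q) = (\<Sum>p\<in>B. \<Sum>q\<in>B. \<Sum>k\<in>A. \<Sum>l\<in>A. g k l p q)"
proof -
  have "(\<Sum>k\<in>A. \<Sum>l\<in>A. \<Sum>p\<in>B. \<Sum>q\<in>B. g k l p q) = (\<Sum>k\<in>A. \<Sum>p\<in>B. \<Sum>q\<in>B. \<Sum>l\<in>A. g k l p q)"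
    by (rule sum.cong[OF refl], subst sum.swap, rule sum.cong[OF refl], rule sum.swap)
  also have "\<dots> = (\<Sum>p\<in>B. \<Sum>q\<in>B. \<Sum>k\<in>A. \<Sum>l\<in>A. g k l p q)"
    by (subst sum.swap, rule sum.cong[OF refl], rule sum.swap)
  finally show ?thesis .
qed

lemma mnorm_corner_le:
  fixes A :: "nat \<Rightarrow> nat \<Rightarrow> 'f::real_normed_field"
  shows "mnorm n n (\<lambda>i j. A i (n + j)) \<le> mnorm (2*n) (2*n) A"
proof (rule mnorm_le)
  fix v :: "nat \<Rightarrow> 'f"
  \<comment> \<open>Padding v by zeros in the first half selects the two right-hand blocks of
    \<open>A\<close>; the lower one is then discarded.\<close>
  define w where "w = (\<lambda>i. if i < n then 0 else v (i - n))"
  have "vsq n (mv n (\<lambda>i j. A i (n + j)) v) = vsq n (mv (2*n) A w)"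
    by (simp add: mv_def w_def sum_lessThan_double)
  also have "\<dots> \<le> vsq (2*n) (mv (2*n) A w)" by (simp add: vsq_double)
  also have "\<dots> \<le> (mnorm (2*n) (2*n) A)\<^sup>2 * vsq (2*n) w" by (rule vsq_mv_le)
  also have "vsq (2*n) w = vsq n v" unfolding vsq_double by (simp add: vsq_def w_def)
  finally show "vsq n (mv n (\<lambda>i j. A i (n + j)) v) \<le> (mnorm (2*n) (2*n) A)\<^sup>2 * vsq n v" .
qed simp

text \<open>Real parts, polarization and limits of hermitian matrices need an additive conjugation,
  which the class does not postulate. The locale isolates this single property, so that it can be
  supplied later by the space \<open>E\<close>; the type token pins down the scalar type.\<close>

locale additive_sconj =
  fixes ty :: "'f::rcl_field itself"
  assumes sconj_add: "sconj (x + y :: 'f) = sconj x + sconj y"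
begin

lemma sconj_minus: "sconj (- x :: 'f) = - sconj x"
  using sconj_add[of x "-x"] by (simp add: sconj_zero eq_neg_iff_add_eq_0 add.commute)

lemma sconj_diff: "sconj (x - y :: 'f) = sconj x - sconj y"
  using sconj_add[of x "-y"] by (simp add: sconj_minus)

lemma sconj_sum: "sconj (sum g A :: 'f) = (\<Sum>i\<in>A. sconj (g i))"
  by (induction A rule: infinite_finite_induct) (simp_all add: sconj_zero sconj_add)

lemma re_part_sconj_sum: "of_real (2 * re_part x) = x + sconj (x::'f)"
proof -
  have "of_real ((norm (x+1))\<^sup>2) = sconj (x+1) * (x+1)" by (rule sconj_mult_self[symmetric])
  also have "\<dots> = sconj x * x + x + sconj x + 1" by (simp add: sconj_add algebra_simps)
  finally have "of_real ((norm (x+1))\<^sup>2) = of_real ((norm x)\<^sup>2) + x + sconj x + 1"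
    by (simp add: sconj_mult_self)
  then show ?thesis by (simp add: re_part_def)
qed

lemma re_part_eqI: "x + sconj (x::'f) = of_real (2 * r) \<Longrightarrow> re_part x = r"
  unfolding re_part_sconj_sum[symmetric] of_real_eq_iff by simp

lemma re_part_add: "re_part (x + y :: 'f) = re_part x + re_part y"
  using re_part_sconj_sum[of x] re_part_sconj_sum[of y]
  by (intro re_part_eqI) (simp add: sconj_add algebra_simps)

lemma re_part_of_real_mult: "re_part (of_real r * x :: 'f) = r * re_part x"
proof (intro re_part_eqI)
  have "of_real r * x + sconj (of_real r * x) = of_real r * (x + sconj x)"
    by (simp add: sconj_times algebra_simps)
  also have "\<dots> = of_real r * of_real (2 * re_part x)" by (simp only: re_part_sconj_sum)
  also have "\<dots> = of_real (2 * (r * re_part x))" by simp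
  finally show "of_real r * x + sconj (of_real r * x) = of_real (2 * (r * re_part x))" .
qed

lemma re_part_of_real [simp]: "re_part (of_real r :: 'f) = r"
  by (rule re_part_eqI) simp

lemma re_part_zero [simp]: "re_part (0 :: 'f) = 0"
  using re_part_of_real[of 0] by simp

lemma re_part_minus: "re_part (- x :: 'f) = - re_part x"
  using re_part_of_real_mult[of "-1" x] by simp

lemma re_part_diff: "re_part (x - y :: 'f) = re_part x - re_part y"
  using re_part_add[of x "-y"] by (simp add: re_part_minus)

lemma re_part_sum: "re_part (sum g A :: 'f) = (\<Sum>i\<in>A. re_part (g i))"
  by (induction A rule: infinite_finite_induct) (simp_all add: re_part_add)

lemma re_part_sconj [simp]: "re_part (sconj x :: 'f) = re_part x"
  by (rule re_part_eqI) (simp add: re_part_sconj_sum[symmetric] add.commute)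

lemma abs_re_part_le: "\<bar>re_part (x::'f)\<bar> \<le> norm x"
proof -
  have "norm (of_real (2 * re_part x) :: 'f) \<le> norm x + norm (sconj x)"
    unfolding re_part_sconj_sum by (rule norm_triangle_ineq)
  then show ?thesis by simp
qed

lemma sa_scalar_real: "sconj x = (x::'f) \<Longrightarrow> of_real (re_part x) = x"
  using re_part_sconj_sum[of x] by (simp add: mult_2[symmetric])

lemma norm_sum_sq: "(norm (x + y :: 'f))\<^sup>2 = (norm x)\<^sup>2 + 2 * re_part (sconj x * y) + (norm y)\<^sup>2"
proof -
  have "(of_real ((norm (x + y))\<^sup>2) :: 'f) = sconj (x+y) * (x+y)" by (simp only: sconj_mult_self)
  also have "\<dots> = sconj x * x + (sconj x * y + sconj (sconj x * y)) + sconj y * y"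
    by (simp add: sconj_add sconj_times algebra_simps)
  also have "\<dots> = of_real ((norm x)\<^sup>2) + of_real (2 * re_part (sconj x * y)) + of_real ((norm y)\<^sup>2)"
    by (simp only: sconj_mult_self re_part_sconj_sum)
  also have "\<dots> = of_real ((norm x)\<^sup>2 + 2 * re_part (sconj x * y) + (norm y)\<^sup>2)"
    by simp
  finally show ?thesis unfolding of_real_eq_iff .
qed

text \<open>This plays the role of the classification of the scalar field. If conjugation is
  trivial, all scalars are real and j = 0 works. Otherwise a skew scalar of norm 1 satisfies j * j =
  -1, and the coordinate of x along j is minus the real part of j * x.\<close>

lemma scalar_decomposition: "\<exists>j. \<forall>x::'f. x = of_real (re_part x) - of_real (re_part (j * x)) * j"
proof (cases "\<forall>x::'f. sconj x = x")
  case True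
  then show ?thesis by (intro exI[of _ 0]) (simp add: sa_scalar_real)
next
  case False
  then obtain y :: 'f where y: "sconj y \<noteq> y" by blast
  define u where "u = y - sconj y"
  have u: "u \<noteq> 0" "sconj u = - u" using y by (simp_all add: u_def sconj_diff)
  define j where "j = of_real (1 / norm u) * u"
  have cj: "sconj j = - j" by (simp add: j_def sconj_times u(2) del: of_real_divide)
  have "norm j = 1" using u(1) by (simp add: j_def norm_divide norm_mult)
  then have jj: "j * j = -1" using sconj_mult_self[of j] cj by (simp add: minus_equation_iff)
  show ?thesis
  proof (intro exI[of _ j] allI)
    fix x :: 'f
    \<comment> \<open>A skew scalar times the skew scalar j is selfconjugate, hence real; this
      identifies the skew part of x as a real multiple of j.\<close>
    define w where "w = x - sconj x"
    have w: "sconj (j * w) = j * w"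
      by (simp add: sconj_times cj w_def sconj_diff algebra_simps)
    have "re_part (j * w) = re_part (j * x) + re_part (sconj j * sconj x)"
      by (simp add: w_def cj right_diff_distrib re_part_diff re_part_minus)
    also have "re_part (sconj j * sconj x) = re_part (j * x)"
      by (metis re_part_sconj sconj_times)
    finally have "re_part (j * w) = 2 * re_part (j * x)" by simp
    with sa_scalar_real[OF w] have "j * w = of_real (2 * re_part (j * x))" by simp
    then have "j * (j * w) = j * of_real (2 * re_part (j * x))" by simp
    then have "- w = 2 * (of_real (re_part (j * x)) * j)"
      by (simp add: mult.assoc[symmetric] jj)
    then have "2 * x = 2 * of_real (re_part x) - 2 * (of_real (re_part (j * x)) * j)"
      using re_part_sconj_sum[of x] by (simp add: w_def algebra_simps) 
    then have "2 * x = 2 * (of_real (re_part x) - of_real (re_part (j * x)) * j)"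
      by (simp only: right_diff_distrib)
    then show "x = of_real (re_part x) - of_real (re_part (j * x)) * j"
      by (subst (asm) mult_cancel_left) simp
  qed
qed

text \<open>Completeness is borrowed from the reals: for each fixed c the real parts of
  \<open>c * X k\<close> are partial sums of a series dominated by a geometric one.\<close>

lemma geometric_convergent:
  fixes X :: "nat \<Rightarrow> 'f"
  assumes "\<And>k. norm (X (Suc k) - X k) \<le> D * \<beta> ^ k" "0 \<le> \<beta>" "\<beta> < 1"
  shows "convergent X"
proof -
  have real: "convergent (\<lambda>k. re_part (c * X k))" for c
  proof -
    have "summable (\<lambda>k. re_part (c * X (Suc k)) - re_part (c * X k))"
    proof (rule summable_comparison_test)
      show "\<exists>N. \<forall>n\<ge>N. norm (re_part (c * X (Suc n)) - re_part (c * X n)) \<le> norm c * D * \<beta> ^ n"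
      proof (intro exI allI impI)
        fix n
        have "norm (re_part (c * X (Suc n)) - re_part (c * X n)) = \<bar>re_part (c * (X (Suc n) - X n))\<bar>"
          by (simp add: right_diff_distrib re_part_diff)
        also have "\<dots> \<le> norm c * norm (X (Suc n) - X n)"
          using abs_re_part_le by (metis norm_mult)
        also have "\<dots> \<le> norm c * (D * \<beta> ^ n)" by (intro mult_left_mono assms) auto
        finally show "norm (re_part (c * X (Suc n)) - re_part (c * X n)) \<le> norm c * D * \<beta> ^ n"
          by (simp add: mult.assoc)
      qed
      show "summable (\<lambda>n. norm c * D * \<beta> ^ n)"
        using assms by (intro summable_mult summable_geometric) auto
    qed
    then have "convergent (\<lambda>n. \<Sum>k<n. re_part (c * X (Suc k)) - re_part (c * X k))"
      by (simp add: summable_iff_convergent)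
    then have "convergent (\<lambda>n. re_part (c * X n) - re_part (c * X 0))"
      by (subst (asm) sum_lessThan_telescope)
    then have "convergent (\<lambda>n. (re_part (c * X n) - re_part (c * X 0)) + re_part (c * X 0))"
      by (intro convergent_add convergent_const)
    then show ?thesis by simp
  qed
  obtain j where j: "\<And>x::'f. x = of_real (re_part x) - of_real (re_part (j * x)) * j"
    using scalar_decomposition by blast
  \<comment> \<open>Taking c = 1 and c = j gives both real coordinates of the sequence, which are
    reassembled by the decomposition.\<close>
  have "convergent (\<lambda>k. of_real (re_part (1 * X k)) - of_real (re_part (j * X k)) * j)"
    using real[of 1] real[of j] unfolding convergent_def
    by (elim exE) (rule exI, erule tendsto_diff[OF tendsto_of_real tendsto_mult_right[OF tendsto_of_real]])
  then show ?thesis using j by simp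
qed


section \<open>Sesquilinear forms\<close>

lemma vsq_add: "vsq n (\<lambda>i. v i + w i :: 'f) = vsq n v + 2 * (\<Sum>i<n. re_part (sconj (v i) * w i)) + vsq n w"
  by (simp add: vsq_def norm_sum_sq sum.distrib sum_distrib_left)

lemma vsq_parallelogram:
  "vsq n (\<lambda>i. v i + w i :: 'f) + vsq n (\<lambda>i. v i - w i) = 2 * (vsq n v + vsq n w)"
  using vsq_add[of n v w] vsq_add[of n v "\<lambda>i. - w i"]
  by (simp add: re_part_minus sum_negf) (simp add: vsq_def)

lemma sform_sconj: "sconj (sform n m w A v) = sform m n v (ctrans A) (w :: nat \<Rightarrow> 'f)"
  by (simp add: sform_def ctrans_def sconj_sum sconj_times algebra_simps)
     (rule sum.swap)

lemma sform_add_left: "sform n m (\<lambda>i. v i + w i :: 'f) A u = sform n m v A u + sform n m w A u"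
  by (simp add: sform_def sconj_add algebra_simps sum.distrib)

lemma sform_diff_left: "sform n m (\<lambda>i. v i - w i :: 'f) A u = sform n m v A u - sform n m w A u"
  by (simp add: sform_def sconj_diff algebra_simps sum_subtractf)

lemma sform_add_right: "sform n m u A (\<lambda>i. v i + w i :: 'f) = sform n m u A v + sform n m u A w"
  by (simp add: sform_def algebra_simps sum.distrib)

lemma sform_diff_right: "sform n m u A (\<lambda>i. v i - w i :: 'f) = sform n m u A v - sform n m u A w"
  by (simp add: sform_def algebra_simps sum_subtractf)

lemma sform_madd: "sform n m u (madd A B) (v :: nat \<Rightarrow> 'f) = sform n m u A v + sform n m u B v"
  by (simp add: sform_def madd_def algebra_simps sum.distrib)

lemma sform_msub: "sform n m u (msub A B) (v :: nat \<Rightarrow> 'f) = sform n m u A v - sform n m u B v"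
  by (simp add: sform_def msub_def algebra_simps sum_subtractf)

lemma sform_herm_real:
  "ctrans A = A \<Longrightarrow> sform n n v A (v :: nat \<Rightarrow> 'f) = of_real (re_part (sform n n v A v))"
  using sform_sconj[of n n v A v] by (simp add: sa_scalar_real)

text \<open>A sum of squares replaces the product of norms in Cauchy-Schwarz: this criterion is
  linear in \<open>A\<close>, symmetric in the two vectors and free of square roots. It is sharp
  when the vectors have equal length, so nothing is lost.\<close>

lemma mnorm_le_form:
  fixes A :: "nat \<Rightarrow> nat \<Rightarrow> 'f"
  assumes r: "r \<ge> 0" and *: "\<And>v w. 2 * re_part (sform n m w A v) \<le> r * (vsq n w + vsq m v)"
  shows "mnorm n m A \<le> r"
proof (rule mnorm_le[OF r])
  fix v
  define u where "u = mv m A v"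
  show "vsq n (mv m A v) \<le> r\<^sup>2 * vsq m v"
  proof (cases "vsq n u = 0 \<or> vsq m v = 0")
    case True
    then have "vsq n u = 0" by (auto simp: u_def vsq_zero_iff mv_def)
    then show ?thesis using r by (simp add: u_def)
  next
    case False
    define \<alpha> where "\<alpha> = sqrt (vsq m v)"
    define \<beta> where "\<beta> = sqrt (vsq n u)"
    have ab: "\<alpha> > 0" "\<beta> > 0" "\<alpha>\<^sup>2 = vsq m v" "\<beta>\<^sup>2 = vsq n u"
      using False by (auto simp: \<alpha>_def \<beta>_def less_le)
    \<comment> \<open>The direction of \<open>A v\<close>, rescaled to the length of v: equality
      case of both Cauchy-Schwarz and the arithmetic-geometric inequality.\<close>
    define w where "w = (\<lambda>i. of_real (\<alpha> / \<beta>) * u i)"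
    have "vsq n w = \<alpha>\<^sup>2" unfolding w_def vsq_scale using ab False
      by (simp add: norm_divide power_divide)
    moreover have "re_part (sform n m w A v) = \<alpha> * \<beta>"
    proof -
      have "sform n m w A v = of_real (\<alpha> / \<beta> * vsq n u)"
        by (simp add: sform_mv w_def u_def[symmetric] sconj_times vsq_def
            sconj_mult_self sum_distrib_left mult.assoc del: of_real_divide of_real_power flip: of_real_mult)
      then have "re_part (sform n m w A v) = \<alpha> / \<beta> * vsq n u" by (simp only: re_part_of_real)
      also have "\<dots> = \<alpha> * \<beta>" using ab by (simp add: ab(4)[symmetric] power2_eq_square)
      finally show ?thesis .
    qed
    ultimately have "2 * (\<alpha> * \<beta>) \<le> r * (\<alpha>\<^sup>2 + \<alpha>\<^sup>2)" using *[of w v] ab by simp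
    then have "\<alpha> * \<beta> \<le> \<alpha> * (r * \<alpha>)" by (simp add: power2_eq_square algebra_simps)
    then have "\<beta> \<le> r * \<alpha>" using ab by simp
    then have "\<beta>\<^sup>2 \<le> (r * \<alpha>)\<^sup>2" using ab by (intro power_mono) auto
    then show ?thesis using ab by (simp add: power_mult_distrib u_def)
  qed
qed

text \<open>Young's inequality with weight r, the norm of \<open>A\<close>, applied entry by entry
  to w and u = \<open>A v\<close>. The weight is divided by, so a vanishing norm is treated
  apart.\<close>

lemma form_le_mnorm:
  fixes A :: "nat \<Rightarrow> nat \<Rightarrow> 'f"
  shows "2 * re_part (sform n m w A v) \<le> mnorm n m A * (vsq n w + vsq m v)"
proof -
  define u where "u = mv m A v"
  define r where "r = mnorm n m A"
  have u: "vsq n u \<le> r\<^sup>2 * vsq m v" unfolding u_def r_def by (rule vsq_mv_le)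
  have r0: "r \<ge> 0" by (simp add: r_def)
  have "2 * re_part (sform n m w A v) \<le> r * (vsq n w + vsq m v)"
  proof (cases "r = 0")
    case True
    then have "\<forall>i<n. u i = 0" using u by (metis mult_zero_left order_antisym power_zero_numeral vsq_nonneg vsq_zero_iff)
    then show ?thesis using True by (simp add: sform_mv u_def)
  next
    case False
    then have r: "r > 0" using r0 by simp
    have "2 * re_part (sform n m w A v) = (\<Sum>i<n. 2 * re_part (sconj (w i) * u i))"
      by (simp add: sform_mv re_part_sum sum_distrib_left u_def)
    also have "\<dots> \<le> (\<Sum>i<n. r * (norm (w i))\<^sup>2 + (norm (u i))\<^sup>2 / r)"
    proof (rule sum_mono)
      fix i
      have "re_part (sconj (w i) * u i) \<le> norm (w i) * norm (u i)"
        using abs_re_part_le[of "sconj (w i) * u i"] by (simp add: norm_mult)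
      moreover have "2 * (norm (w i) * norm (u i)) \<le> r * (norm (w i))\<^sup>2 + (norm (u i))\<^sup>2 / r"
      proof -
        have "0 \<le> (r * norm (w i) - norm (u i))\<^sup>2 / r" using r by simp
        then show ?thesis using r by (simp add: power2_eq_square field_simps)
      qed
      ultimately show "2 * re_part (sconj (w i) * u i) \<le> r * (norm (w i))\<^sup>2 + (norm (u i))\<^sup>2 / r" by simp
    qed
    also have "\<dots> = r * vsq n w + vsq n u / r"
      by (simp add: vsq_def sum.distrib sum_distrib_left sum_divide_distrib)
    also have "vsq n u / r \<le> r * vsq m v" using u r by (simp add: field_simps power2_eq_square)
    finally show ?thesis by (simp add: algebra_simps)
  qed
  then show ?thesis by (simp add: r_def)
qed

lemma diag_form_le_mnorm:
  fixes A :: "nat \<Rightarrow> nat \<Rightarrow> 'f"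
  shows "re_part (sform n n v A v) \<le> mnorm n n A * vsq n v"
  using form_le_mnorm[of n n v A v] by simp

lemma mnorm_ctrans_le: "mnorm m n (ctrans A) \<le> mnorm n m (A :: nat \<Rightarrow> nat \<Rightarrow> 'f)"
proof (rule mnorm_le_form)
  fix v w :: "nat \<Rightarrow> 'f"
  show "2 * re_part (sform m n w (ctrans A) v) \<le> mnorm n m A * (vsq m w + vsq n v)"
    using form_le_mnorm[of n m v A w]
    by (simp add: sform_sconj[symmetric] add.commute)
qed simp

lemma hermitian_mnorm_le:
  fixes A :: "nat \<Rightarrow> nat \<Rightarrow> 'f"
  assumes r: "r \<ge> 0" and h: "ctrans A = A"
    and *: "\<And>v. \<bar>re_part (sform n n v A v)\<bar> \<le> r * vsq n v"
  shows "mnorm n n A \<le> r"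
proof (rule mnorm_le_form[OF r])
  fix v w :: "nat \<Rightarrow> 'f"
  let ?a = "\<lambda>i. v i + w i" and ?b = "\<lambda>i. v i - w i"
  have s: "re_part (sform n n v A w) = re_part (sform n n w A v)"
    using sform_sconj[of n n v A w] h by (metis re_part_sconj)
  \<comment> \<open>Only the real part of the mixed term is wanted, and hermitian symmetry gives
    both mixed terms the same real part. Two polarization terms therefore suffice over the complex
    numbers as well.\<close>
  have "4 * re_part (sform n n w A v) = re_part (sform n n ?a A ?a) - re_part (sform n n ?b A ?b)"
    by (simp add: sform_add_left sform_add_right sform_diff_left sform_diff_right re_part_add re_part_diff s)
  also have "\<dots> \<le> r * vsq n ?a + r * vsq n ?b"
    using *[of ?a] *[of ?b] by linarith
  also have "\<dots> = r * (2 * (vsq n v + vsq n w))"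
    by (simp only: vsq_parallelogram distrib_left[symmetric])
  finally show "2 * re_part (sform n n w A v) \<le> r * (vsq n w + vsq n v)"
    by (simp add: algebra_simps)
qed

lemma psdI:
  fixes A :: "nat \<Rightarrow> nat \<Rightarrow> 'f"
  assumes "A \<in> mats n n" "ctrans A = A" "\<And>v. 0 \<le> re_part (sform n n v A v)"
  shows "psd n A"
  unfolding psd_def
  using assms sform_herm_real[OF assms(2), of n] unfolding sform_def by blast

lemma mnorm_smul_le: "mnorm m p (smul m n p a b) \<le> mnorm m n a * mnorm n p (b :: nat \<Rightarrow> nat \<Rightarrow> 'f)"
proof (rule mnorm_le)
  fix v
  have "vsq m (mv p (smul m n p a b) v) = vsq m (mv n a (mv p b v))"
    by (rule vsq_cong) (rule mv_smul)
  also have "\<dots> \<le> (mnorm m n a)\<^sup>2 * vsq n (mv p b v)" by (rule vsq_mv_le)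
  also have "\<dots> \<le> (mnorm m n a)\<^sup>2 * ((mnorm n p b)\<^sup>2 * vsq p v)"
    by (intro mult_left_mono vsq_mv_le) auto
  finally show "vsq m (mv p (smul m n p a b) v) \<le> (mnorm m n a * mnorm n p b)\<^sup>2 * vsq p v"
    by (simp add: power_mult_distrib mult.assoc)
qed simp

lemma sform_cong:
  fixes v :: "nat \<Rightarrow> 'f"
  assumes "\<And>i. i < n \<Longrightarrow> v i = v' i" "\<And>i. i < m \<Longrightarrow> w i = w' i"
  shows "sform n m v A w = sform n m v' A w'"
  using assms by (simp add: sform_def)

lemma sum_sconj_mv_ctrans:
  fixes v :: "nat \<Rightarrow> 'f"
  shows "(\<Sum>i<m. sconj (v i) * mv n (ctrans a) u i) = (\<Sum>k<n. sconj (mv m a v k) * u k)"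
proof -
  have "(\<Sum>i<m. sconj (v i) * mv n (ctrans a) u i) = (\<Sum>i<m. \<Sum>k<n. sconj (v i) * sconj (a k i) * u k)"
    by (simp add: mv_def ctrans_def sum_distrib_left mult.assoc)
  also have "\<dots> = (\<Sum>k<n. \<Sum>i<m. sconj (v i) * sconj (a k i) * u k)" by (rule sum.swap)
  also have "\<dots> = (\<Sum>k<n. sconj (mv m a v k) * u k)"
    by (simp add: mv_def sconj_sum sconj_times sum_distrib_right mult.commute[of "sconj (v _)"])
  finally show ?thesis .
qed

text \<open>On forms, compression by a is substitution of a v for v. Bounds on a thereby become
  bounds on compressed forms.\<close>

lemma sform_compress:
  fixes v :: "nat \<Rightarrow> 'f"
  shows "sform m m v (smul m n m (ctrans a) (smul n n m G a)) v = sform n n (mv m a v) G (mv m a v)"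
proof -
  have "sform m m v (smul m n m (ctrans a) (smul n n m G a)) v
    = (\<Sum>i<m. sconj (v i) * mv n (ctrans a) (mv m (smul n n m G a) v) i)"
    unfolding sform_mv by (simp add: mv_smul)
  also have "\<dots> = (\<Sum>k<n. sconj (mv m a v k) * mv m (smul n n m G a) v k)"
    by (rule sum_sconj_mv_ctrans)
  also have "\<dots> = sform n n (mv m a v) G (mv m a v)"
    unfolding sform_mv by (simp add: mv_smul)
  finally show ?thesis .
qed

lemma sform_scaled: "sform n m w (\<lambda>i j. of_real r * A i j) (v :: nat \<Rightarrow> 'f) = of_real r * sform n m w A v"
  by (simp add: sform_def sum_distrib_left algebra_simps)

lemma mnorm_scaled_le:
  assumes "r \<ge> 0" "mnorm n m (A :: nat \<Rightarrow> nat \<Rightarrow> 'f) \<le> b"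
  shows "mnorm n m (\<lambda>i j. of_real r * A i j) \<le> r * b"
proof (rule mnorm_le_form)
  show "0 \<le> r * b" using assms mnorm_nonneg[of n m A] by (intro mult_nonneg_nonneg) linarith+
  fix v w :: "nat \<Rightarrow> 'f"
  have "2 * re_part (sform n m w (\<lambda>i j. of_real r * A i j) v) = r * (2 * re_part (sform n m w A v))"
    by (simp add: sform_scaled re_part_of_real_mult)
  also have "\<dots> \<le> r * (mnorm n m A * (vsq n w + vsq m v))"
    by (intro mult_left_mono form_le_mnorm assms)
  also have "\<dots> \<le> r * (b * (vsq n w + vsq m v))"
    by (intro mult_left_mono mult_right_mono assms) auto
  finally show "2 * re_part (sform n m w (\<lambda>i j. of_real r * A i j) v) \<le> r * b * (vsq n w + vsq m v)"
    by (simp add: mult.assoc)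
qed

lemma mnorm_madd_le: "mnorm n m (madd A B) \<le> mnorm n m A + mnorm n m (B :: nat \<Rightarrow> nat \<Rightarrow> 'f)"
proof (rule mnorm_le_form)
  fix v w :: "nat \<Rightarrow> 'f"
  show "2 * re_part (sform n m w (madd A B) v) \<le> (mnorm n m A + mnorm n m B) * (vsq n w + vsq m v)"
    using form_le_mnorm[of n m w A v] form_le_mnorm[of n m w B v]
    by (simp add: sform_madd re_part_add algebra_simps)
qed simp

lemma sform_idm: "sform n n w (idm n) (v :: nat \<Rightarrow> 'f) = (\<Sum>i<n. sconj (w i) * v i)"
  by (simp add: sform_def idm_def if_distrib[of "\<lambda>x. _ * x"] if_distrib[of "\<lambda>x. x * _"] cong: if_cong)

lemma re_sform_idm: "re_part (sform n n v (idm n) (v :: nat \<Rightarrow> 'f)) = vsq n v"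
  by (simp add: sform_idm sconj_mult_self re_part_sum vsq_def del: of_real_power)

lemma ctrans_idm [simp]: "ctrans (idm n) = (idm n :: nat \<Rightarrow> nat \<Rightarrow> 'f)"
  by (auto simp: ctrans_def idm_def sconj_zero fun_eq_iff)

lemma mnorm_idm_le: "mnorm n n (idm n :: nat \<Rightarrow> nat \<Rightarrow> 'f) \<le> 1"
  by (rule hermitian_mnorm_le) (simp_all add: re_sform_idm)

section \<open>Square roots of positive definite matrices\<close>

text \<open>Banach's fixed point theorem, with distances measured by \<open>mnorm\<close> but
  closedness and continuity required entrywise. The two are linked by the fact that
  \<open>mnorm\<close> dominates each entry, so the entries of the iterates move by geometrically
  decreasing steps.\<close>

lemma matrix_contraction_fixpoint:
  fixes \<Phi> :: "(nat \<Rightarrow> nat \<Rightarrow> 'f) \<Rightarrow> nat \<Rightarrow> nat \<Rightarrow> 'f"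
  assumes S: "S \<subseteq> mats n n" "X0 \<in> S" "\<And>X. X \<in> S \<Longrightarrow> \<Phi> X \<in> S"
    and closed: "\<And>X L. (\<And>k. X k \<in> S) \<Longrightarrow> (\<And>i j. (\<lambda>k. X k i j) \<longlonglongrightarrow> L i j) \<Longrightarrow> L \<in> S"
    and cont: "\<And>X L i j. (\<And>i j. (\<lambda>k. X k i j) \<longlonglongrightarrow> L i j) \<Longrightarrow> (\<lambda>k. \<Phi> (X k) i j) \<longlonglongrightarrow> \<Phi> L i j"
    and contr: "\<And>X Y. X \<in> S \<Longrightarrow> Y \<in> S \<Longrightarrow> mnorm n n (msub (\<Phi> X) (\<Phi> Y)) \<le> \<beta> * mnorm n n (msub X Y)"
    and \<beta>: "0 \<le> \<beta>" "\<beta> < 1"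
  shows "\<exists>L\<in>S. \<Phi> L = L"
proof -
  define X where "X = (\<lambda>k. (\<Phi> ^^ k) X0)"
  have XS: "X k \<in> S" for k by (induction k) (simp_all add: X_def S)
  have X_Suc: "X (Suc k) = \<Phi> (X k)" for k by (simp add: X_def)
  define D where "D = mnorm n n (msub (X 1) (X 0))"
  have step: "mnorm n n (msub (X (Suc k)) (X k)) \<le> D * \<beta> ^ k" for k
  proof (induction k)
    case (Suc k)
    have "mnorm n n (msub (X (Suc (Suc k))) (X (Suc k))) \<le> \<beta> * mnorm n n (msub (X (Suc k)) (X k))"
      using contr[OF XS[of "Suc k"] XS[of k]] by (simp add: X_Suc)
    also have "\<dots> \<le> \<beta> * (D * \<beta> ^ k)" by (intro mult_left_mono Suc.IH \<beta>)
    finally show ?case by (simp add: algebra_simps)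
  qed (simp add: D_def)
  have conv: "convergent (\<lambda>k. X k i j)" for i j
  proof (cases "i < n \<and> j < n")
    case True
    have "norm (X (Suc k) i j - X k i j) \<le> D * \<beta> ^ k" for k
      using norm_entry_le_mnorm[where i=i and j=j and n=n and m=n and A="msub (X (Suc k)) (X k)"] True step[of k]
      by (simp add: msub_def)
    then show ?thesis using \<beta> by (rule geometric_convergent)
  next
    case False
    then have "X k i j = 0" for k using XS[of k] S(1) by (auto simp: mats_def)
    then show ?thesis by (simp add: convergent_const)
  qed
  define L where "L = (\<lambda>i j. lim (\<lambda>k. X k i j))"
  have lim: "(\<lambda>k. X k i j) \<longlonglongrightarrow> L i j" for i j
    using conv by (simp add: L_def convergent_LIMSEQ_iff)
  have "L \<in> S" using XS lim by (rule closed)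
  moreover have "\<Phi> L i j = L i j" for i j
    using cont[where X=X and L=L and i=i and j=j, OF lim] LIMSEQ_Suc[OF lim[of i j]] LIMSEQ_unique by (simp add: X_Suc) blast
  ultimately show ?thesis by blast
qed

end

section \<open>Algebra of scalar matrices and entrywise limits\<close>

lemma smul_assoc:
  "smul m p q (smul m n p a b) c = smul m n q a (smul n p q b c)"
proof (intro ext)
  fix i j
  show "smul m p q (smul m n p a b) c i j = smul m n q a (smul n p q b c) i j"
  proof (cases "i < m \<and> j < q")
    case True
    then have "smul m p q (smul m n p a b) c i j = (\<Sum>k<p. \<Sum>l<n. a i l * b l k * c k j)"
      by (simp add: smul_def sum_distrib_right)
    also have "\<dots> = (\<Sum>l<n. \<Sum>k<p. a i l * b l k * c k j)" by (rule sum.swap)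
    finally show ?thesis using True by (simp add: smul_def sum_distrib_left mult.assoc)
  qed (auto simp: smul_def)
qed

lemma smul_scaled_left: "smul m n p (\<lambda>i j. c * a i j) b = (\<lambda>i j. c * smul m n p a b i j)"
  by (auto simp: smul_def fun_eq_iff sum_distrib_left algebra_simps)

lemma smul_scaled_right: "smul m n p a (\<lambda>i j. c * b i j) = (\<lambda>i j. c * smul m n p a b i j)"
  by (auto simp: smul_def fun_eq_iff sum_distrib_left algebra_simps)

lemma smul_idm_left: "a \<in> mats m n \<Longrightarrow> smul m m n (idm m) a = a"
  by (auto simp: smul_def idm_def mats_def fun_eq_iff if_distrib[of "\<lambda>x. x * _"] cong: if_cong)

lemma smul_idm_right: "a \<in> mats m n \<Longrightarrow> smul m n n a (idm n) = a"
  by (auto simp: smul_def idm_def mats_def fun_eq_iff if_distrib[of "\<lambda>x. _ * x"] cong: if_cong)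

lemma smul_msub_right: "smul m n p a (msub b c) = msub (smul m n p a b) (smul m n p a c)"
  by (auto simp: smul_def msub_def fun_eq_iff algebra_simps sum_subtractf)

lemma smul_msub_left: "smul m n p (msub a b) c = msub (smul m n p a c) (smul m n p b c)"
  by (auto simp: smul_def msub_def fun_eq_iff algebra_simps sum_subtractf)

lemma idm_mats [simp]: "idm n \<in> mats n n"
  by (auto simp: idm_def mats_def)

lemma madd_mats [simp]: "a \<in> mats n m \<Longrightarrow> b \<in> mats n m \<Longrightarrow> madd a b \<in> mats n m" for a b :: "nat \<Rightarrow> nat \<Rightarrow> 'a::monoid_add"
  by (simp add: mats_def madd_def)

lemma msub_mats [simp]: "a \<in> mats n m \<Longrightarrow> b \<in> mats n m \<Longrightarrow> msub a b \<in> mats n m" for a b :: "nat \<Rightarrow> nat \<Rightarrow> 'a::ab_group_add"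
  by (simp add: mats_def msub_def)

lemma mats_lim:
  fixes L :: "nat \<Rightarrow> nat \<Rightarrow> 'a::real_normed_vector"
  assumes "\<And>k. X k \<in> mats n m" "\<And>i j. (\<lambda>k. X k i j) \<longlonglongrightarrow> L i j"
  shows "L \<in> mats n m"
  unfolding mats_def
proof (intro CollectI allI impI)
  fix i j assume "\<not> (i < n \<and> j < m)"
  then have "(\<lambda>k. X k i j) = (\<lambda>k. 0)" using assms(1) by (auto simp: mats_def)
  then show "L i j = 0" using assms(2)[of i j] by (simp add: LIMSEQ_const_iff)
qed

lemma tendsto_smul:
  fixes L M :: "nat \<Rightarrow> nat \<Rightarrow> 'a::real_normed_field"
  assumes "\<And>i j. (\<lambda>k. X k i j) \<longlonglongrightarrow> L i j" "\<And>i j. (\<lambda>k. Y k i j) \<longlonglongrightarrow> M i j"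
  shows "(\<lambda>k. smul m n p (X k) (Y k) i j) \<longlonglongrightarrow> smul m n p L M i j"
  by (cases "i < m \<and> j < p") (auto simp: smul_def intro!: tendsto_intros assms)

lemma mnorm_le_lim:
  fixes L :: "nat \<Rightarrow> nat \<Rightarrow> 'a::real_normed_field"
  assumes "\<And>k. mnorm n m (X k) \<le> r" "\<And>i j. (\<lambda>k. X k i j) \<longlonglongrightarrow> L i j" "0 \<le> r"
  shows "mnorm n m L \<le> r"
proof (rule mnorm_le[OF assms(3)])
  fix v
  have "(\<lambda>k. vsq n (mv m (X k) v)) \<longlonglongrightarrow> vsq n (mv m L v)"
    unfolding vsq_def mv_def by (intro tendsto_intros assms)
  moreover have "vsq n (mv m (X k) v) \<le> r\<^sup>2 * vsq m v" for k
  proof -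
    have "(mnorm n m (X k))\<^sup>2 * vsq m v \<le> r\<^sup>2 * vsq m v"
      using assms(1) by (intro mult_right_mono power_mono) auto
    with vsq_mv_le[of n m "X k" v] show ?thesis by linarith
  qed
  ultimately show "vsq n (mv m L v) \<le> r\<^sup>2 * vsq m v"
    by (meson LIMSEQ_le_const2)
qed

context additive_sconj
begin

lemma tendsto_sconj: "X \<longlonglongrightarrow> (L::'f) \<Longrightarrow> (\<lambda>k. sconj (X k)) \<longlonglongrightarrow> sconj L"
  by (simp add: LIMSEQ_iff sconj_diff[symmetric])

lemma ctrans_lim:
  fixes L :: "nat \<Rightarrow> nat \<Rightarrow> 'f"
  assumes "\<And>k. ctrans (X k) = X k" "\<And>i j. (\<lambda>k. X k i j) \<longlonglongrightarrow> L i j"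
  shows "ctrans L = L"
proof (intro ext)
  fix i j
  have "(\<lambda>k. sconj (X k j i)) \<longlonglongrightarrow> ctrans L i j"
    unfolding ctrans_def by (intro tendsto_sconj assms)
  moreover have "(\<lambda>k. sconj (X k j i)) = (\<lambda>k. X k i j)"
    using assms(1) by (metis ctrans_def)
  ultimately show "ctrans L i j = L i j" using assms(2)[of i j] LIMSEQ_unique by metis
qed

lemma ctrans_smul: "ctrans (smul m n p a b) = smul p n m (ctrans b) (ctrans (a :: nat \<Rightarrow> nat \<Rightarrow> 'f))"
  by (auto simp: smul_def ctrans_def fun_eq_iff sconj_zero sconj_sum sconj_times mult.commute)

lemma ctrans_madd: "ctrans (madd a b) = madd (ctrans a) (ctrans (b :: nat \<Rightarrow> nat \<Rightarrow> 'f))"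
  by (simp add: ctrans_def madd_def sconj_add)

lemma ctrans_msub: "ctrans (msub a b) = msub (ctrans a) (ctrans (b :: nat \<Rightarrow> nat \<Rightarrow> 'f))"
  by (simp add: ctrans_def msub_def sconj_diff)

lemma ctrans_mats: "a \<in> mats n m \<Longrightarrow> ctrans (a :: nat \<Rightarrow> nat \<Rightarrow> 'f) \<in> mats m n"
  by (auto simp: ctrans_def mats_def sconj_zero)

text \<open>A fixed point of Z = I + Y Z is a right inverse of the hermitian matrix I - Y, and its
  adjoint is a left inverse. Two one-sided inverses coincide, so Z is hermitian and
  two-sided.\<close>

lemma neumann_inverse:
  fixes Y :: "nat \<Rightarrow> nat \<Rightarrow> 'f"
  assumes Y: "Y \<in> mats n n" "ctrans Y = Y" "mnorm n n Y \<le> \<beta>" "\<beta> < 1"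
  shows "\<exists>d\<in>mats n n. ctrans d = d \<and> smul n n n (msub (idm n) Y) d = idm n \<and>
           smul n n n d (msub (idm n) Y) = idm n"
proof -
  have \<beta>: "0 \<le> \<beta>" using Y(3) mnorm_nonneg[of n n Y] by linarith
  have "\<exists>Z\<in>mats n n. madd (idm n) (smul n n n Y Z) = Z"
  proof (rule matrix_contraction_fixpoint[where \<beta> = \<beta>])
    show "idm n \<in> mats n n" by simp
  next
    fix X Z :: "nat \<Rightarrow> nat \<Rightarrow> 'f" assume "X \<in> mats n n" "Z \<in> mats n n"
    have "msub (madd (idm n) (smul n n n Y X)) (madd (idm n) (smul n n n Y Z)) = smul n n n Y (msub X Z)"
      unfolding smul_msub_right by (simp add: msub_def madd_def)
    then have "mnorm n n (msub (madd (idm n) (smul n n n Y X)) (madd (idm n) (smul n n n Y Z)))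
      \<le> mnorm n n Y * mnorm n n (msub X Z)" by (simp add: mnorm_smul_le)
    also have "\<dots> \<le> \<beta> * mnorm n n (msub X Z)" by (intro mult_right_mono Y) simp
    finally show "mnorm n n (msub (madd (idm n) (smul n n n Y X)) (madd (idm n) (smul n n n Y Z)))
      \<le> \<beta> * mnorm n n (msub X Z)" .
  next
    fix X :: "nat \<Rightarrow> nat \<Rightarrow> nat \<Rightarrow> 'f" and L i j assume "\<And>i j. (\<lambda>k. X k i j) \<longlonglongrightarrow> L i j"
    then have "(\<lambda>k. smul n n n Y (X k) i j) \<longlonglongrightarrow> smul n n n Y L i j" by (intro tendsto_smul) auto
    then show "(\<lambda>k. madd (idm n) (smul n n n Y (X k)) i j) \<longlonglongrightarrow> madd (idm n) (smul n n n Y L) i j"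
      unfolding madd_def by (intro tendsto_intros)
  qed (use \<beta> Y(4) in \<open>auto intro: mats_lim\<close>)
  then obtain Z where Z: "Z \<in> mats n n" "madd (idm n) (smul n n n Y Z) = Z" by blast
  define X where "X = msub (idm n) Y"
  have X: "X \<in> mats n n" "ctrans X = X" by (simp_all add: X_def Y ctrans_msub)
  have XZ: "smul n n n X Z = idm n"
  proof -
    have "smul n n n X Z = msub Z (smul n n n Y Z)" by (simp add: X_def smul_msub_left smul_idm_left Z)
    also have "\<dots> = msub (madd (idm n) (smul n n n Y Z)) (smul n n n Y Z)" by (simp add: Z)
    also have "\<dots> = idm n" by (simp add: msub_def madd_def)
    finally show ?thesis .
  qed
  have ZX: "smul n n n (ctrans Z) X = idm n"
    using arg_cong[OF XZ, of ctrans] by (simp add: ctrans_smul X)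
  have "smul n n n (ctrans Z) (smul n n n X Z) = smul n n n (smul n n n (ctrans Z) X) Z"
    by (simp add: smul_assoc)
  then have "ctrans Z = Z" by (simp add: XZ ZX smul_idm_left smul_idm_right Z ctrans_mats)
  then show ?thesis using Z XZ ZX unfolding X_def by metis
qed

text \<open>\<open>(I - Y)\<^sup>2 = I - B\<close> is the fixed point equation \<open>Y = (B + Y\<^sup>2) / 2\<close>, whose right-hand side is a
  \<open>\<beta>\<close>-contraction on the ball of radius \<open>\<beta>\<close>.\<close>
lemma near_identity_sqrt:
  fixes B :: "nat \<Rightarrow> nat \<Rightarrow> 'f"
  assumes B: "B \<in> mats n n" "ctrans B = B" "mnorm n n B \<le> \<beta>" "\<beta> < 1"
  shows "\<exists>Y\<in>mats n n. ctrans Y = Y \<and> mnorm n n Y \<le> \<beta> \<and>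
           smul n n n (msub (idm n) Y) (msub (idm n) Y) = msub (idm n) B"
proof -
  have \<beta>: "0 \<le> \<beta>" using B(3) mnorm_nonneg[of n n B] by linarith
  let ?S = "{Y \<in> mats n n. ctrans Y = (Y :: nat \<Rightarrow> nat \<Rightarrow> 'f) \<and> mnorm n n Y \<le> \<beta>}"
  define \<Phi> where "\<Phi> = (\<lambda>Y i j. of_real (1/2) * madd B (smul n n n Y Y) i j)"
  have "\<exists>Y\<in>?S. \<Phi> Y = Y"
  proof (rule matrix_contraction_fixpoint[where \<beta> = \<beta>])
    show "B \<in> ?S" using B by simp
  next
    fix Y assume Y: "Y \<in> ?S"
    have "mnorm n n (\<Phi> Y) \<le> 1/2 * (\<beta> + \<beta> * \<beta>)"
      unfolding \<Phi>_def
    proof (rule mnorm_scaled_le)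
      have "mnorm n n (madd B (smul n n n Y Y)) \<le> mnorm n n B + mnorm n n (smul n n n Y Y)"
        by (rule mnorm_madd_le)
      also have "mnorm n n (smul n n n Y Y) \<le> mnorm n n Y * mnorm n n Y" by (rule mnorm_smul_le)
      also have "mnorm n n Y * mnorm n n Y \<le> \<beta> * \<beta>" using Y by (intro mult_mono) (auto simp: \<beta>)
      finally show "mnorm n n (madd B (smul n n n Y Y)) \<le> \<beta> + \<beta> * \<beta>" using B(3) by linarith
    qed simp
    also have "\<dots> \<le> \<beta>" using \<beta> B(4) mult_left_le[of \<beta> \<beta>] by simp
    finally have "mnorm n n (\<Phi> Y) \<le> \<beta>" .
    moreover have "ctrans (\<Phi> Y) = \<Phi> Y"
    proof -
      have "ctrans (\<Phi> Y) = (\<lambda>i j. of_real (1/2) * ctrans (madd B (smul n n n Y Y)) i j)"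
        unfolding ctrans_def \<Phi>_def sconj_times sconj_of_real ..
      then show ?thesis using Y B by (simp add: ctrans_madd ctrans_smul \<Phi>_def)
    qed
    moreover have "\<Phi> Y \<in> mats n n"
      using madd_mats[OF B(1) smul_mats[of n n n Y Y]] by (simp add: mats_def \<Phi>_def)
    ultimately show "\<Phi> Y \<in> ?S" by simp
  next
    fix X L assume *: "\<And>k::nat. X k \<in> ?S" "\<And>i j. (\<lambda>k. X k i j) \<longlonglongrightarrow> (L i j :: 'f)"
    from *(1) have "\<And>k. X k \<in> mats n n" "\<And>k. ctrans (X k) = X k" "\<And>k. mnorm n n (X k) \<le> \<beta>" by auto
    then show "L \<in> ?S"
      using mats_lim[where X=X and L=L, OF _ *(2)] ctrans_lim[where X=X and L=L, OF _ *(2)]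
        mnorm_le_lim[where X=X and L=L, OF _ *(2) \<beta>]
      by blast
  next
    fix X :: "nat \<Rightarrow> nat \<Rightarrow> nat \<Rightarrow> 'f" and L i j assume *: "\<And>i j. (\<lambda>k. X k i j) \<longlonglongrightarrow> L i j"
    show "(\<lambda>k. \<Phi> (X k) i j) \<longlonglongrightarrow> \<Phi> L i j"
      unfolding \<Phi>_def madd_def by (intro tendsto_intros tendsto_smul *)
  next
    fix X Y assume X: "X \<in> ?S" and Y: "Y \<in> ?S"
    let ?D = "msub X Y"
    \<comment> \<open>Difference of squares without commutativity: XX - YY = X(X - Y) + (X - Y)Y.
      The factor 1/2 then compensates for the two terms of size \<beta>.\<close>
    have eq: "msub (\<Phi> X) (\<Phi> Y) = (\<lambda>i j. of_real (1/2) * madd (smul n n n X ?D) (smul n n n ?D Y) i j)"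
      unfolding smul_msub_right smul_msub_left \<Phi>_def by (simp add: msub_def madd_def algebra_simps)
    have "mnorm n n (msub (\<Phi> X) (\<Phi> Y)) \<le> 1/2 * (2 * \<beta> * mnorm n n ?D)"
      unfolding eq
    proof (rule mnorm_scaled_le)
      have "mnorm n n (madd (smul n n n X ?D) (smul n n n ?D Y))
        \<le> mnorm n n (smul n n n X ?D) + mnorm n n (smul n n n ?D Y)" by (rule mnorm_madd_le)
      also have "mnorm n n (smul n n n X ?D) \<le> mnorm n n X * mnorm n n ?D" by (rule mnorm_smul_le)
      also have "mnorm n n X * mnorm n n ?D \<le> \<beta> * mnorm n n ?D" using X by (intro mult_right_mono) auto
      also have "mnorm n n (smul n n n ?D Y) \<le> mnorm n n ?D * mnorm n n Y" by (rule mnorm_smul_le)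
      also have "mnorm n n ?D * mnorm n n Y \<le> mnorm n n ?D * \<beta>" using Y by (intro mult_left_mono) auto
      finally show "mnorm n n (madd (smul n n n X ?D) (smul n n n ?D Y)) \<le> 2 * \<beta> * mnorm n n ?D"
        by simp
    qed simp
    then show "mnorm n n (msub (\<Phi> X) (\<Phi> Y)) \<le> \<beta> * mnorm n n ?D" by simp
  qed (use \<beta> B(4) in auto)
  then obtain Y where Y: "Y \<in> ?S" "\<Phi> Y = Y" by blast
  have "smul n n n (msub (idm n) Y) (msub (idm n) Y) = msub (idm n) B"
  proof (intro ext)
    fix i j
    have "Y i j = of_real (1/2) * (B i j + smul n n n Y Y i j)"
      using Y(2) by (auto simp: \<Phi>_def madd_def fun_eq_iff)
    then have "Y i j + Y i j = B i j + smul n n n Y Y i j" by (simp add: field_simps)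
    moreover have "smul n n n (msub (idm n) Y) (msub (idm n) Y) = msub (msub (idm n) Y) (msub Y (smul n n n Y Y))"
      using Y by (simp add: smul_msub_left smul_msub_right smul_idm_left smul_idm_right)
    ultimately show "smul n n n (msub (idm n) Y) (msub (idm n) Y) i j = msub (idm n) B i j"
      by (simp add: msub_def algebra_simps)
  qed
  with Y show ?thesis by blast
qed

lemma ctrans_scaled: "ctrans a = a \<Longrightarrow> ctrans (\<lambda>i j. of_real r * a i j) = (\<lambda>i j. of_real r * a i j :: 'f)"
  by (simp add: ctrans_def sconj_times fun_eq_iff)

text \<open>After division by a number M that exceeds the norm, \<open>A\<close> differs from the
  identity by a hermitian \<open>B\<close> of norm below 1. The fixed point construction gives a
  root of \<open>A / M\<close>, the Neumann argument inverts it, and both are scaled back by the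
  square root of M.\<close>

lemma positive_definite_sqrt:
  fixes A :: "nat \<Rightarrow> nat \<Rightarrow> 'f"
  assumes A: "A \<in> mats n n" "ctrans A = A" and \<delta>: "\<delta> > 0"
    and pos: "\<And>v. \<delta> * vsq n v \<le> re_part (sform n n v A v)"
  shows "\<exists>c d. psd n c \<and> smul n n n c c = A \<and> d \<in> mats n n \<and> ctrans d = d \<and>
           smul n n n c d = idm n \<and> smul n n n d c = idm n"
proof -
  \<comment> \<open>Adding \<delta> makes M positive and at least \<delta> at once, so \<beta> = 1 -
    \<delta>/M lies in [0, 1). The form of \<open>A / M\<close> lies between \<delta>/M and 1, which
    is the bound on \<open>B\<close>.\<close>
  define M where "M = mnorm n n A + \<delta>"
  have M: "M > 0" "\<delta> \<le> M" using \<delta> mnorm_nonneg[of n n A] by (simp_all add: M_def add_nonneg_pos)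
  define \<beta> where "\<beta> = 1 - \<delta> / M"
  have \<beta>: "0 \<le> \<beta>" "\<beta> < 1" using M \<delta> by (simp_all add: \<beta>_def)
  define A' where "A' = (\<lambda>i j. of_real (1 / M) * A i j)"
  define B where "B = msub (idm n) A'"
  have A': "A' \<in> mats n n" "ctrans A' = A'"
    using A by (simp_all add: A'_def mats_def ctrans_scaled del: of_real_divide)
  have B: "B \<in> mats n n" "ctrans B = B" using A' by (simp_all add: B_def ctrans_msub)
  have "mnorm n n B \<le> \<beta>"
  proof (rule hermitian_mnorm_le[OF \<beta>(1) B(2)])
    fix v
    define q where "q = re_part (sform n n v A v)"
    have "re_part (sform n n v B v) = vsq n v - q / M"
      by (simp add: B_def A'_def sform_msub re_part_diff re_sform_idm sform_scaled re_part_of_real_mult q_def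
          del: of_real_divide)
    moreover have "\<delta> * vsq n v \<le> q" unfolding q_def by (rule pos)
    moreover have "q \<le> M * vsq n v"
      using diag_form_le_mnorm[of n v A] mult_nonneg_nonneg[OF less_imp_le[OF \<delta>] vsq_nonneg[of n v]]
      by (simp add: M_def q_def distrib_right)
    ultimately show "\<bar>re_part (sform n n v B v)\<bar> \<le> \<beta> * vsq n v"
      using M by (simp add: \<beta>_def field_simps abs_le_iff)
  qed
  from near_identity_sqrt[OF B this \<beta>(2)] obtain Y where Y: "Y \<in> mats n n" "ctrans Y = Y" "mnorm n n Y \<le> \<beta>"
    and sq: "smul n n n (msub (idm n) Y) (msub (idm n) Y) = msub (idm n) B" by blast
  define X where "X = msub (idm n) Y"
  from neumann_inverse[OF Y \<beta>(2)] obtain d where d: "d \<in> mats n n" "ctrans d = d"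
    "smul n n n X d = idm n" "smul n n n d X = idm n" unfolding X_def by blast
  have X: "X \<in> mats n n" "ctrans X = X" using Y by (simp_all add: X_def ctrans_msub)
  define s where "s = sqrt M"
  have s: "s > 0" "s * s = M" using M by (simp_all add: s_def)
  define c where "c = (\<lambda>i j. of_real s * X i j)"
  define e where "e = (\<lambda>i j. of_real (1 / s) * d i j)"
  have XX: "smul n n n X X = A'" using sq by (simp add: X_def B_def msub_def)
  have "smul n n n c c = (\<lambda>i j. of_real (s * s) * A' i j)"
    by (simp add: c_def smul_scaled_left smul_scaled_right XX mult.assoc)
  also have "\<dots> = A" using M by (simp add: s A'_def)
  finally have cc: "smul n n n c c = A" .
  have "psd n c"
  proof (rule psdI)
    show "c \<in> mats n n" using X by (simp add: c_def mats_def)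
    show "ctrans c = c" unfolding c_def by (rule ctrans_scaled[OF X(2)])
    fix v
    \<comment> \<open>Positivity of the root comes from the radius of the ball that contains Y: I -
      Y is positive as soon as the norm of Y is at most 1.\<close>
    have "re_part (sform n n v Y v) \<le> mnorm n n Y * vsq n v" by (rule diag_form_le_mnorm)
    also have "\<dots> \<le> 1 * vsq n v" using Y(3) \<beta>(2) by (intro mult_right_mono) auto
    finally have "0 \<le> re_part (sform n n v X v)"
      by (simp add: X_def sform_msub re_part_diff re_sform_idm)
    then show "0 \<le> re_part (sform n n v c v)"
      using s by (simp add: c_def sform_scaled re_part_of_real_mult)
  qed
  moreover have "e \<in> mats n n" "ctrans e = e"
    using d by (simp_all add: e_def mats_def ctrans_scaled del: of_real_divide)
  moreover have "smul n n n c e = idm n" "smul n n n e c = idm n"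
    using s d by (simp_all add: c_def e_def smul_scaled_left smul_scaled_right del: of_real_divide)
      (simp_all add: fun_eq_iff)
  ultimately show ?thesis using cc by blast
qed

end

section \<open>Selection matrices\<close>

definition selection :: "nat \<Rightarrow> (nat \<Rightarrow> 'f::zero) \<Rightarrow> (nat \<Rightarrow> nat) \<Rightarrow> nat \<Rightarrow> nat \<Rightarrow> 'f" where
  "selection p c \<tau> = (\<lambda>k i. if i < p \<and> k = \<tau> i then c i else 0)"

lemma selection_mats: "(\<And>i. i < p \<Longrightarrow> \<tau> i < n) \<Longrightarrow> selection p c \<tau> \<in> mats n p"
  by (auto simp: selection_def mats_def)

text \<open>The columns outside \<open>P\<close> have weight 0, so \<tau> may take a dummy value
  there and injectivity is needed only on \<open>P\<close>. Such a matrix is a partial isometry that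
  keeps the coordinates in \<open>P\<close>.\<close>

lemma vsq_selection:
  fixes v :: "nat \<Rightarrow> 'f::real_normed_field"
  assumes \<tau>: "\<And>i. i < p \<Longrightarrow> \<tau> i < n" and inj: "inj_on \<tau> {i. i < p \<and> P i}"
  shows "vsq n (mv p (selection p (\<lambda>i. if P i then 1 else 0) \<tau>) v) = (\<Sum>i<p. if P i then (norm (v i))\<^sup>2 else 0)"
proof -
  let ?Q = "{i. i < p \<and> P i}" and ?u = "mv p (selection p (\<lambda>i. if P i then 1 else 0) \<tau>) v"
  have u: "?u k = (\<Sum>i\<in>?Q. if \<tau> i = k then v i else 0)" for k
  proof -
    have "?u k = (\<Sum>i<p. if P i then (if \<tau> i = k then v i else 0) else 0)"
      unfolding mv_def selection_def by (rule sum.cong) auto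
    also have "\<dots> = (\<Sum>i\<in>?Q. if \<tau> i = k then v i else 0)"
      by (simp add: sum.inter_filter[symmetric])
    finally show ?thesis .
  qed
  have u1: "?u (\<tau> i) = v i" if "i \<in> ?Q" for i
  proof -
    have "?u (\<tau> i) = (\<Sum>i'\<in>?Q. if i' = i then v i' else 0)"
      unfolding u using inj that by (intro sum.cong) (auto dest: inj_onD)
    then show ?thesis using that by simp
  qed
  have u0: "?u k = 0" if "k \<notin> \<tau> ` ?Q" for k
    unfolding u using that by (intro sum.neutral) auto
  have "vsq n ?u = (\<Sum>k\<in>\<tau> ` ?Q. (norm (?u k))\<^sup>2)"
    unfolding vsq_def using \<tau> u0 by (intro sum.mono_neutral_right) auto
  also have "\<dots> = (\<Sum>i\<in>?Q. (norm (v i))\<^sup>2)"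
    using inj u1 by (simp add: sum.reindex)
  also have "\<dots> = (\<Sum>i<p. if P i then (norm (v i))\<^sup>2 else 0)"
    by (simp add: sum.inter_filter[symmetric])
  finally show ?thesis .
qed

lemma vsq_selection_le:
  fixes v :: "nat \<Rightarrow> 'f::real_normed_field"
  assumes "\<And>i. i < p \<Longrightarrow> \<tau> i < n" "inj_on \<tau> {..<p}"
  shows "vsq n (mv p (selection p (\<lambda>i. 1) \<tau>) v) \<le> 1 * vsq p v"
  using vsq_selection[of p \<tau> n "\<lambda>_. True" v] assms by (simp add: vsq_def lessThan_def)

lemma dsum_mats: "x \<in> mats n n \<Longrightarrow> y \<in> mats m m \<Longrightarrow> dsum n x y \<in> mats (n + m) (n + m)"
proof -
  assume xy: "x \<in> mats n n" "y \<in> mats m m"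
  have "dsum n x y i j = 0" if "n + m \<le> i \<or> n + m \<le> j" for i j
  proof -
    have "m \<le> i - n \<or> m \<le> j - n" using that by linarith
    then show ?thesis using that mats_zero[OF xy(2), of "i - n" "j - n"] by (auto simp: dsum_def)
  qed
  then show ?thesis unfolding mats_def by (simp add: not_less)
qed

section \<open>Matrix base ordered spaces\<close>

locale matrix_base_space =
  fixes scale :: "'f::rcl_field \<Rightarrow> 'e::ab_group_add \<Rightarrow> 'e"
    and st :: "'e \<Rightarrow> 'e"
    and C K :: "nat \<Rightarrow> (nat \<Rightarrow> nat \<Rightarrow> 'e) set"
    and f1 :: "'e \<Rightarrow> 'f"
  assumes base: "matrix_base_ordered scale st C K f1"
begin

sublocale E: vector_space scale
  using base by (simp add: matrix_base_ordered_def matrix_ordered_def star_vector_space_def)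

lemma st_add: "st (x + y) = st x + st y"
  and st_scale: "st (scale c x) = scale (sconj c) (st x)"
  and st_st [simp]: "st (st x) = x"
  using base by (auto simp: matrix_base_ordered_def matrix_ordered_def star_vector_space_def)

lemma C_msa: "n > 0 \<Longrightarrow> x \<in> C n \<Longrightarrow> x \<in> msa st n"
  and C_zero: "n > 0 \<Longrightarrow> mzero \<in> C n"
  and C_add: "n > 0 \<Longrightarrow> x \<in> C n \<Longrightarrow> y \<in> C n \<Longrightarrow> madd x y \<in> C n"
  and C_scale: "n > 0 \<Longrightarrow> x \<in> C n \<Longrightarrow> t \<ge> 0 \<Longrightarrow> mscale scale (of_real t) x \<in> C n"
  and C_compress: "n > 0 \<Longrightarrow> m > 0 \<Longrightarrow> a \<in> mats n m \<Longrightarrow> x \<in> C n \<Longrightarrow>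
    mmul scale m n m (ctrans a) x a \<in> C m"
proof -
  have "matrix_ordered scale st C" using base by (simp add: matrix_base_ordered_def)
  note m = this[unfolded matrix_ordered_def, THEN conjunct2]
  note 1 = m[THEN conjunct1, rule_format] and 2 = m[THEN conjunct2, rule_format]
  show "n > 0 \<Longrightarrow> x \<in> C n \<Longrightarrow> x \<in> msa st n" using 1[of n] by (meson subsetD)
  show "n > 0 \<Longrightarrow> mzero \<in> C n" using 1[of n] by meson
  show "n > 0 \<Longrightarrow> x \<in> C n \<Longrightarrow> y \<in> C n \<Longrightarrow> madd x y \<in> C n"
    using 1[of n] by simp
  show "n > 0 \<Longrightarrow> x \<in> C n \<Longrightarrow> t \<ge> 0 \<Longrightarrow> mscale scale (of_real t) x \<in> C n"
    using 1[of n] by simp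
  show "n > 0 \<Longrightarrow> m > 0 \<Longrightarrow> a \<in> mats n m \<Longrightarrow> x \<in> C n \<Longrightarrow>
    mmul scale m n m (ctrans a) x a \<in> C m" by (rule 2)
qed

lemma f_add: "f1 (x + y) = f1 x + f1 y"
  and f_scale: "f1 (scale c x) = c * f1 x"
  and f_st: "f1 (st x) = sconj (f1 x)"
  and f_pos: "e11 x \<in> C 1 \<Longrightarrow> x \<noteq> 0 \<Longrightarrow> \<exists>r>0. f1 x = of_real r"
  using base by (auto simp: matrix_base_ordered_def strictly_pos_sa_functional_def)

lemma K_iff: "n > 0 \<Longrightarrow> x \<in> K n \<longleftrightarrow> x \<in> C n \<and> fmap f1 x = idm n"
  using base by (auto simp: matrix_base_ordered_def)

lemma dominated: "n > 0 \<Longrightarrow> x \<in> msa st n \<Longrightarrow>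
    \<exists>t::real>0. \<exists>k\<in>K n. msub (mscale scale (of_real t) k) x \<in> C n"
  using base by (auto simp: matrix_base_ordered_def)

lemma separated:
  assumes "n > 0" "x \<in> msa st n"
    "\<And>\<epsilon>. \<epsilon> > 0 \<Longrightarrow> \<exists>y\<in>C n. \<exists>z\<in>C n. x = msub y z \<and>
            mnorm n n (fmap f1 y) < \<epsilon> \<and> mnorm n n (fmap f1 z) < \<epsilon>"
  shows "x = mzero"
  using base assms unfolding matrix_base_ordered_def by blast

lemma f_zero [simp]: "f1 0 = 0"
  using f_add[of 0 0] by simp

lemma st_zero [simp]: "st 0 = 0"
  using st_add[of 0 0] by simp

lemma st_minus: "st (- x) = - st x"
  using st_add[of x "- x"] by (simp add: eq_neg_iff_add_eq_0 add.commute)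

lemma st_sum: "st (sum g A) = (\<Sum>i\<in>A. st (g i))"
  by (induction A rule: infinite_finite_induct) (simp_all add: st_add)

lemma f_minus: "f1 (- x) = - f1 x"
  using f_add[of x "- x"] by (simp add: eq_neg_iff_add_eq_0 add.commute)

lemma f_diff: "f1 (x - y) = f1 x - f1 y"
  using f_add[of x "- y"] by (simp add: f_minus)

lemma f_sum: "f1 (sum g A) = (\<Sum>i\<in>A. f1 (g i))"
  by (induction A rule: infinite_finite_induct) (simp_all add: f_add)

lemma mzero_msa [simp]: "mzero \<in> msa st n"
  by (simp add: msa_def mats_def mstar_def mzero_def)

lemma K_nonempty: "n > 0 \<Longrightarrow> \<exists>k. k \<in> K n"
  using dominated[of n mzero] by auto

text \<open>The class \<open>rcl_field\<close> does not postulate additivity of the conjugation; it is forced by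
  the conjugate-linear involution on the nonzero space \<open>E\<close>.\<close>
sublocale additive_sconj "TYPE('f)"
proof
  fix c d :: 'f
  obtain k where k: "k \<in> K 1" using K_nonempty[of 1] by auto
  define e where "e = st (k 0 0)"
  have "fmap f1 k 0 0 = 1" using k by (simp add: K_iff idm_def)
  then have "k 0 0 \<noteq> 0" by (auto simp: fmap_def)
  then have e: "e \<noteq> 0" unfolding e_def by (metis st_st st_zero)
  have "scale (sconj (c + d)) e = scale (sconj c + sconj d) e"
    unfolding e_def
    by (simp only: st_scale[symmetric] E.scale_left_distrib st_add)
  then show "sconj (c + d) = sconj c + sconj d"
    using e by (simp add: E.scale_cancel_right)
qed

abbreviation compress :: "nat \<Rightarrow> nat \<Rightarrow> (nat \<Rightarrow> nat \<Rightarrow> 'f) \<Rightarrow> (nat \<Rightarrow> nat \<Rightarrow> 'e) \<Rightarrow> nat \<Rightarrow> nat \<Rightarrow> 'e" where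
  "compress m n a x \<equiv> mmul scale m n m (ctrans a) x a"

abbreviation norm_sa :: "nat \<Rightarrow> (nat \<Rightarrow> nat \<Rightarrow> 'e) \<Rightarrow> real" where
  "norm_sa \<equiv> bnorm_sa scale f1 C"

section \<open>Matrices over the space, amplifications of the base function and compressions\<close>

lemma fmap_madd: "fmap f1 (madd x y) = madd (fmap f1 x) (fmap f1 y)"
  by (simp add: fmap_def madd_def f_add)

lemma fmap_msub: "fmap f1 (msub x y) = msub (fmap f1 x) (fmap f1 y)"
  by (simp add: fmap_def msub_def f_diff)

lemma fmap_mscale: "fmap f1 (mscale scale c x) = (\<lambda>i j. c * fmap f1 x i j)"
  by (simp add: fmap_def mscale_def f_scale)

lemma fmap_mats: "x \<in> mats n m \<Longrightarrow> fmap f1 x \<in> mats n m"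
  by (simp add: fmap_def mats_def)

lemma ctrans_fmap: "x \<in> msa st n \<Longrightarrow> ctrans (fmap f1 x) = fmap f1 x"
  by (auto simp: msa_def ctrans_def fmap_def mstar_def f_st[symmetric] fun_eq_iff)

lemma fmap_mmul: "fmap f1 (mmul scale m n p a x b) = smul m n p a (smul n n p (fmap f1 x) b)"
  by (auto simp: fmap_def mmul_def smul_def f_sum f_scale sum_distrib_left algebra_simps fun_eq_iff
      intro!: sum.cong)

lemma msa_mats: "x \<in> msa st n \<Longrightarrow> x \<in> mats n n"
  by (simp add: msa_def)

lemma msa_entry: "x \<in> msa st n \<Longrightarrow> st (x i j) = x j i"
  by (auto simp: msa_def mstar_def fun_eq_iff)

lemma msaI: "x \<in> mats n n \<Longrightarrow> (\<And>i j. st (x i j) = x j i) \<Longrightarrow> x \<in> msa st n"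
  by (simp add: msa_def mstar_def)

lemma msa_madd: "x \<in> msa st n \<Longrightarrow> y \<in> msa st n \<Longrightarrow> madd x y \<in> msa st n"
  by (intro msaI) (auto simp: msa_mats, simp add: madd_def st_add msa_entry)

lemma msa_mneg: "x \<in> msa st n \<Longrightarrow> mneg x \<in> msa st n"
  by (intro msaI) (auto simp: mneg_def st_minus msa_entry, simp add: msa_def mats_def)

lemma mmul_mats [simp]: "mmul scale m n p a x b \<in> mats m p"
  by (simp add: mmul_def mats_def)

lemma msa_compress: "x \<in> msa st n \<Longrightarrow> compress m n a x \<in> msa st m"
proof (rule msaI)
  fix i j assume x: "x \<in> msa st n"
  show "st (compress m n a x i j) = compress m n a x j i"
    unfolding mmul_def using x
    by (auto simp: st_sum st_scale msa_entry ctrans_def sconj_times algebra_simps intro: sum.swap)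
qed simp

lemma mmul_madd: "mmul scale m n p a (madd x y) b = madd (mmul scale m n p a x b) (mmul scale m n p a y b)"
  by (auto simp: mmul_def madd_def E.scale_right_distrib sum.distrib fun_eq_iff)

lemma mmul_msub: "mmul scale m n p a (msub x y) b = msub (mmul scale m n p a x b) (mmul scale m n p a y b)"
  by (auto simp: mmul_def msub_def E.scale_right_diff_distrib sum_subtractf fun_eq_iff)

lemma mmul_mmul:
  "mmul scale n n n c (mmul scale n n n d x d') c' = mmul scale n n n (smul n n n c d) x (smul n n n d' c')"
proof (intro ext)
  fix i j
  show "mmul scale n n n c (mmul scale n n n d x d') c' i j
    = mmul scale n n n (smul n n n c d) x (smul n n n d' c') i j"
  proof (cases "i < n \<and> j < n")
    case True
    then have "mmul scale n n n c (mmul scale n n n d x d') c' i j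
      = (\<Sum>k<n. \<Sum>l<n. \<Sum>p<n. \<Sum>q<n. scale (c i k * c' l j * (d k p * d' q l)) (x p q))"
      by (simp add: mmul_def E.scale_sum_right)
    also have "\<dots> = (\<Sum>p<n. \<Sum>q<n. \<Sum>k<n. \<Sum>l<n. scale (c i k * c' l j * (d k p * d' q l)) (x p q))"
      by (rule sum_swap_pairs)
    also have "\<dots> = mmul scale n n n (smul n n n c d) x (smul n n n d' c') i j"
      using True by (simp add: mmul_def smul_def sum_product E.scale_sum_left[symmetric] algebra_simps)
    finally show ?thesis .
  qed (auto simp: mmul_def)
qed

lemma mmul_idm: "x \<in> mats n n \<Longrightarrow> mmul scale n n n (idm n) x (idm n) = x"
  by (auto simp: mmul_def idm_def mats_def fun_eq_iff if_distrib[of "\<lambda>c. scale c _"]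
      if_distrib[of "\<lambda>c. c * _"] if_distrib[of "\<lambda>c. _ * c"] cong: if_cong)

text \<open>Column i has its only possible nonzero entry in row \<open>\<tau> i\<close>, so both
  inner sums collapse. All reindexings of blocks below (folding, swapping, embedding, cutting
  corners) are of this kind.\<close>

lemma compress_selection:
  assumes \<tau>: "\<And>i. i < p \<Longrightarrow> \<tau> i < n"
  shows "compress p n (selection p c \<tau>) x =
    (\<lambda>i j. if i < p \<and> j < p then scale (sconj (c i) * c j) (x (\<tau> i) (\<tau> j)) else 0)"
proof (intro ext)
  fix i j
  show "compress p n (selection p c \<tau>) x i j =
    (if i < p \<and> j < p then scale (sconj (c i) * c j) (x (\<tau> i) (\<tau> j)) else 0)"
  proof (cases "i < p \<and> j < p")
    case True
    then have "compress p n (selection p c \<tau>) x i j =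
      (\<Sum>k<n. \<Sum>l<n. if k = \<tau> i then (if l = \<tau> j then scale (sconj (c i) * c j) (x k l) else 0) else 0)"
      by (auto simp: mmul_def ctrans_def selection_def sconj_zero intro!: sum.cong)
    also have "\<dots> = (\<Sum>k<n. if k = \<tau> i then scale (sconj (c i) * c j) (x k (\<tau> j)) else 0)"
      using \<tau> True by (intro sum.cong) auto
    also have "\<dots> = scale (sconj (c i) * c j) (x (\<tau> i) (\<tau> j))"
      using \<tau> True by simp
    finally show ?thesis using True by simp
  qed (auto simp: mmul_def)
qed

text \<open>A positive functional is completely positive: compressing y by the column v gives a 1 x
  1 positive matrix on which \<open>f1\<close> takes the value \<open>v\<^sup>* f1(y) v\<close>.
  Strict positivity speaks only of nonzero elements, hence the separate zero case.\<close>

lemma sform_fmap_nonneg: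
  assumes "n > 0" "y \<in> C n"
  shows "0 \<le> re_part (sform n n v (fmap f1 y) v)"
proof -
  define a where "a = (\<lambda>k i. if k < n \<and> i = (0::nat) then v k else 0)"
  define X where "X = compress 1 n a y"
  have "a \<in> mats n 1" by (auto simp: a_def mats_def)
  then have X: "X \<in> C 1" unfolding X_def using assms by (intro C_compress) auto
  then have "X \<in> mats 1 1" using C_msa[of 1 X] by (simp add: msa_mats)
  then have e: "X = e11 (X 0 0)" by (auto simp: e11_def mats_def fun_eq_iff)
  have "\<exists>r\<ge>0. f1 (X 0 0) = of_real r"
  proof (cases "X 0 0 = 0")
    case True
    then show ?thesis by (intro exI[of _ 0]) simp
  next
    case False
    then show ?thesis using f_pos[of "X 0 0"] X e by (metis less_imp_le)
  qed
  then have nn: "0 \<le> re_part (f1 (X 0 0))" by auto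
  have "f1 (X 0 0) = sform 1 1 (\<lambda>_. 1) (fmap f1 X) (\<lambda>_. 1)"
    by (simp add: sform_def fmap_def)
  also have "\<dots> = sform n n (mv 1 a (\<lambda>_. 1)) (fmap f1 y) (mv 1 a (\<lambda>_. 1))"
    unfolding X_def fmap_mmul by (rule sform_compress)
  also have "\<dots> = sform n n v (fmap f1 y) v"
    by (rule sform_cong) (simp_all add: mv_def a_def)
  finally show ?thesis using nn by simp
qed

lemma sform_fmap_compress:
  "sform m m v (fmap f1 (compress m n a x)) v = sform n n (mv m a v) (fmap f1 x) (mv m a v)"
  unfolding fmap_mmul by (rule sform_compress)

lemma mnorm_fmap_le:
  assumes "n > 0" "y \<in> C n" "r \<ge> 0" "\<And>v. re_part (sform n n v (fmap f1 y) v) \<le> r * vsq n v"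
  shows "mnorm n n (fmap f1 y) \<le> r"
  using assms sform_fmap_nonneg[OF assms(1,2)]
  by (intro hermitian_mnorm_le ctrans_fmap C_msa) auto

section \<open>The norm on selfadjoint matrices\<close>

lemma norm_sa_le:
  assumes "n > 0" "y \<in> C n" "z \<in> C n" "x = msub y z" "r \<ge> 0"
    and "\<And>v. re_part (sform n n v (fmap f1 (madd y z)) v) \<le> r * vsq n v"
  shows "norm_sa n x \<le> r"
  unfolding bnorm_sa_def
proof (rule cInf_lower2)
  show "mnorm n n (fmap f1 (madd y z)) \<in> {mnorm n n (fmap f1 (madd y z)) | y z. y \<in> C n \<and> z \<in> C n \<and> x = msub y z}"
    using assms by blast
  show "mnorm n n (fmap f1 (madd y z)) \<le> r"
    using assms by (intro mnorm_fmap_le C_add) auto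
  show "bdd_below {mnorm n n (fmap f1 (madd y z)) | y z. y \<in> C n \<and> z \<in> C n \<and> x = msub y z}"
    by (rule bdd_belowI[of _ 0]) auto
qed

text \<open>Domination by an element of \<open>K\<close> gives x = tk - (tk - x), so the infimum
  ranges over a nonempty set.\<close>

lemma decomposition_nonempty:
  assumes "n > 0" "x \<in> msa st n"
  shows "{mnorm n n (fmap f1 (madd y z)) | y z. y \<in> C n \<and> z \<in> C n \<and> x = msub y z} \<noteq> {}"
proof -
  obtain t k where t: "t > 0" "k \<in> K n" and z: "msub (mscale scale (of_real t) k) x \<in> C n"
    using dominated[OF assms] by blast
  let ?y = "mscale scale (of_real t) k"
  have "?y \<in> C n" using assms t by (intro C_scale) (auto simp: K_iff)
  moreover have "x = msub ?y (msub ?y x)" by (simp add: msub_def)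
  ultimately show ?thesis using z by blast
qed

text \<open>The strict inequality is essential, since the infimum need not be attained. Every later
  use adds a slack that is removed at the end.\<close>

lemma norm_sa_less:
  assumes "n > 0" "x \<in> msa st n" "norm_sa n x < r"
  shows "\<exists>y\<in>C n. \<exists>z\<in>C n. x = msub y z \<and>
           (\<forall>v. re_part (sform n n v (fmap f1 (madd y z)) v) \<le> r * vsq n v)"
proof -
  obtain y z where yz: "y \<in> C n" "z \<in> C n" "x = msub y z" and lt: "mnorm n n (fmap f1 (madd y z)) < r"
    using cInf_lessD[OF decomposition_nonempty[OF assms(1,2)] assms(3)[unfolded bnorm_sa_def]] by blast
  have "re_part (sform n n v (fmap f1 (madd y z)) v) \<le> r * vsq n v" for v
  proof -
    have "mnorm n n (fmap f1 (madd y z)) * vsq n v \<le> r * vsq n v"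
      using lt by (intro mult_right_mono) auto
    with diag_form_le_mnorm[of n v "fmap f1 (madd y z)"] show ?thesis by linarith
  qed
  with yz show ?thesis by blast
qed

lemma norm_sa_nonneg: "n > 0 \<Longrightarrow> x \<in> msa st n \<Longrightarrow> 0 \<le> norm_sa n x"
  unfolding bnorm_sa_def by (rule cInf_greatest[OF decomposition_nonempty]) auto

lemma norm_sa_mneg: "norm_sa n (mneg x) = norm_sa n x"
proof -
  have "{mnorm n n (fmap f1 (madd y z)) | y z. y \<in> C n \<and> z \<in> C n \<and> mneg x = msub y z}
    = {mnorm n n (fmap f1 (madd y z)) | y z. y \<in> C n \<and> z \<in> C n \<and> x = msub y z}" (is "?A = ?B")
  proof -
    have m: "mneg x = msub y z \<longleftrightarrow> x = msub z y" for x y z :: "nat \<Rightarrow> nat \<Rightarrow> 'e"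
      unfolding mneg_def msub_def fun_eq_iff by (metis minus_diff_eq minus_minus)
    have c: "madd y z = madd z y" for y z :: "nat \<Rightarrow> nat \<Rightarrow> 'e"
      by (simp add: madd_def add.commute)
    show ?thesis unfolding m using c by (auto; metis)
  qed
  then show ?thesis by (simp add: bnorm_sa_def)
qed

lemma norm_sa_triangle:
  assumes "n > 0" "x \<in> msa st n" "y \<in> msa st n"
  shows "norm_sa n (madd x y) \<le> norm_sa n x + norm_sa n y"
proof (rule field_le_epsilon)
  fix e :: real assume e: "e > 0"
  obtain x1 x2 where x: "x1 \<in> C n" "x2 \<in> C n" "x = msub x1 x2"
    "\<And>v. re_part (sform n n v (fmap f1 (madd x1 x2)) v) \<le> (norm_sa n x + e/2) * vsq n v"
    using norm_sa_less[OF assms(1,2), of "norm_sa n x + e/2"] e by auto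
  obtain y1 y2 where y: "y1 \<in> C n" "y2 \<in> C n" "y = msub y1 y2"
    "\<And>v. re_part (sform n n v (fmap f1 (madd y1 y2)) v) \<le> (norm_sa n y + e/2) * vsq n v"
    using norm_sa_less[OF assms(1,3), of "norm_sa n y + e/2"] e by auto
  show "norm_sa n (madd x y) \<le> norm_sa n x + norm_sa n y + e"
  proof (rule norm_sa_le[OF assms(1)])
    show "madd x1 y1 \<in> C n" "madd x2 y2 \<in> C n" using x y assms by (auto intro: C_add)
    show "madd x y = msub (madd x1 y1) (madd x2 y2)"
      by (simp add: x y madd_def msub_def algebra_simps)
    show "0 \<le> norm_sa n x + norm_sa n y + e"
      using e norm_sa_nonneg[OF assms(1,2)] norm_sa_nonneg[OF assms(1,3)] by simp
    fix v
    show "re_part (sform n n v (fmap f1 (madd (madd x1 y1) (madd x2 y2))) v)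
      \<le> (norm_sa n x + norm_sa n y + e) * vsq n v"
      using x(4)[of v] y(4)[of v] by (simp add: fmap_madd sform_madd re_part_add algebra_simps)
  qed
qed

lemma norm_sa_zero: "n > 0 \<Longrightarrow> norm_sa n mzero = 0"
  by (intro antisym norm_sa_nonneg norm_sa_le[where y=mzero and z=mzero])
     (simp_all add: C_zero, simp_all add: mzero_def msub_def madd_def fmap_def sform_def)

text \<open>The separation axiom asks for y and z to be small separately, whereas the norm controls
  their sum. As both forms are nonnegative, each is dominated by the form of y + z.\<close>

lemma norm_sa_eq_zero:
  assumes n: "n > 0" and x: "x \<in> msa st n" and 0: "norm_sa n x = 0"
  shows "x = mzero"
proof (rule separated[OF n x])
  fix e :: real assume e: "e > 0"
  obtain y z where yz: "y \<in> C n" "z \<in> C n" "x = msub y z"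
    "\<And>v. re_part (sform n n v (fmap f1 (madd y z)) v) \<le> e/2 * vsq n v"
    using norm_sa_less[OF n x, of "e/2"] e 0 by auto
  have le: "re_part (sform n n v (fmap f1 y) v) \<le> e/2 * vsq n v"
    "re_part (sform n n v (fmap f1 z) v) \<le> e/2 * vsq n v" for v
    using yz(4)[of v] sform_fmap_nonneg[OF n yz(1), of v] sform_fmap_nonneg[OF n yz(2), of v]
    by (simp_all add: fmap_madd sform_madd re_part_add)
  have "mnorm n n (fmap f1 y) \<le> e/2" by (rule mnorm_fmap_le[OF n yz(1) _ le(1)]) (use e in simp)
  moreover have "mnorm n n (fmap f1 z) \<le> e/2" by (rule mnorm_fmap_le[OF n yz(2) _ le(2)]) (use e in simp)
  ultimately show "\<exists>y\<in>C n. \<exists>z\<in>C n. x = msub y z \<and> mnorm n n (fmap f1 y) < e \<and> mnorm n n (fmap f1 z) < e"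
    using yz e by (intro bexI[of _ y] bexI[of _ z]) auto
qed

lemma norm_sa_compress2:
  assumes pos: "p > 0" "n > 0" "m > 0" and ab: "a \<in> mats n p" "b \<in> mats m p"
    and x: "x \<in> msa st n" "norm_sa n x \<le> R" and y: "y \<in> msa st m" "norm_sa m y \<le> R"
    and c: "\<And>v. vsq n (mv p a v) + vsq m (mv p b v) \<le> c * vsq p v" "c \<ge> 0"
  shows "norm_sa p (madd (compress p n a x) (compress p m b y)) \<le> c * R"
proof (rule field_le_epsilon)
  fix e :: real assume e: "e > 0"
  \<comment> \<open>The denominator c + 1 keeps the slack within e after multiplication by c, and is
    positive even for c = 0.\<close>
  define R' where "R' = R + e / (c + 1)"
  have R: "R \<ge> 0" using norm_sa_nonneg[OF pos(2) x(1)] x(2) by linarith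
  have R': "R' > R" "R' \<ge> 0" using e c(2) R by (simp_all add: R'_def)
  obtain x1 x2 where x': "x1 \<in> C n" "x2 \<in> C n" "x = msub x1 x2"
    "\<And>v. re_part (sform n n v (fmap f1 (madd x1 x2)) v) \<le> R' * vsq n v"
    using norm_sa_less[OF pos(2) x(1), of R'] x(2) R' by auto
  obtain y1 y2 where y': "y1 \<in> C m" "y2 \<in> C m" "y = msub y1 y2"
    "\<And>v. re_part (sform m m v (fmap f1 (madd y1 y2)) v) \<le> R' * vsq m v"
    using norm_sa_less[OF pos(3) y(1), of R'] y(2) R' by auto
  let ?g = "\<lambda>x y. madd (compress p n a x) (compress p m b y)"
  have "norm_sa p (?g x y) \<le> c * R'"
  proof (rule norm_sa_le[OF pos(1)])
    show "?g x1 y1 \<in> C p" "?g x2 y2 \<in> C p" using pos ab x' y' by (auto intro!: C_add C_compress)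
    show "?g x y = msub (?g x1 y1) (?g x2 y2)"
      unfolding x' y' mmul_msub by (simp add: madd_def msub_def algebra_simps)
    show "0 \<le> c * R'" using c R' by simp
    fix v
    have "madd (?g x1 y1) (?g x2 y2) = ?g (madd x1 x2) (madd y1 y2)"
      unfolding mmul_madd by (simp add: madd_def algebra_simps)
    then have "re_part (sform p p v (fmap f1 (madd (?g x1 y1) (?g x2 y2))) v)
      = re_part (sform n n (mv p a v) (fmap f1 (madd x1 x2)) (mv p a v))
      + re_part (sform m m (mv p b v) (fmap f1 (madd y1 y2)) (mv p b v))"
      by (simp add: fmap_madd[of "compress p n a (madd x1 x2)"] sform_madd re_part_add sform_fmap_compress)
    also have "\<dots> \<le> R' * (vsq n (mv p a v) + vsq m (mv p b v))"
      using x'(4)[of "mv p a v"] y'(4)[of "mv p b v"] by (simp add: distrib_left)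
    also have "\<dots> \<le> R' * (c * vsq p v)" using c R' by (intro mult_left_mono) auto
    finally show "re_part (sform p p v (fmap f1 (madd (?g x1 y1) (?g x2 y2))) v) \<le> c * R' * vsq p v"
      by (simp add: algebra_simps)
  qed
  also have "c * R' \<le> c * R + e"
    using e c(2) by (simp add: R'_def field_simps)
  finally show "norm_sa p (?g x y) \<le> c * R + e" .
qed

lemma norm_sa_compress:
  assumes "p > 0" "n > 0" "a \<in> mats n p" "x \<in> msa st n"
    and "\<And>v. vsq n (mv p a v) \<le> c * vsq p v" "c \<ge> 0"
  shows "norm_sa p (compress p n a x) \<le> c * norm_sa n x"
proof -
  have "norm_sa p (madd (compress p n a x) (compress p n mzero x)) \<le> c * norm_sa n x"
    using assms by (intro norm_sa_compress2) (auto simp: mats_def mzero_def mv_def vsq_def)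
  moreover have "compress p n mzero x = mzero"
    by (simp add: mmul_def mzero_def ctrans_def sconj_zero fun_eq_iff)
  ultimately show ?thesis by (simp add: madd_def mzero_def)
qed

section \<open>The norm of non-selfadjoint matrices\<close>

abbreviation nrm :: "nat \<Rightarrow> (nat \<Rightarrow> nat \<Rightarrow> 'e) \<Rightarrow> real" where
  "nrm \<equiv> bnorm scale st f1 C"

lemma offdiag_msa: "offdiag st n x \<in> msa st (2 * n)"
  by (rule msaI) (auto simp: offdiag_def mats_def)

lemma offdiag_simps:
  assumes "i < n" "j < n"
  shows "offdiag st n x i j = 0" "offdiag st n x i (n + j) = x i j"
    "offdiag st n x (n + i) j = st (x j i)" "offdiag st n x (n + i) (n + j) = 0"
  using assms by (simp_all add: offdiag_def)

text \<open>Selfadjointness determines the lower left block from the upper right one, so three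
  blocks remain to be compared.\<close>

lemma offdiag_eqI:
  assumes X: "X \<in> msa st (2 * n)"
    and "\<And>i j. i < n \<Longrightarrow> j < n \<Longrightarrow> X i j = 0"
    and "\<And>i j. i < n \<Longrightarrow> j < n \<Longrightarrow> X i (n + j) = x i j"
    and "\<And>i j. i < n \<Longrightarrow> j < n \<Longrightarrow> X (n + i) (n + j) = 0"
  shows "X = offdiag st n x"
proof (intro ext)
  fix i j
  have split: "k < n \<or> (\<exists>l<n. k = n + l) \<or> 2 * n \<le> k" for k
    using le_Suc_ex[of n k] by (cases "k < n") (auto simp: not_less)
  have lower: "X (n + i) j = st (x j i)" if "i < n" "j < n" for i j
    using msa_entry[OF X, of j "n + i"] assms(3)[OF that(2,1)] by simp
  have out: "X i j = 0" "offdiag st n x i j = 0" if "2 * n \<le> i \<or> 2 * n \<le> j"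
    using that mats_zero[OF msa_mats[OF X]] mats_zero[OF msa_mats[OF offdiag_msa]] by blast+
  show "X i j = offdiag st n x i j"
  proof (cases "2 * n \<le> i \<or> 2 * n \<le> j")
    case False
    then show ?thesis
      using split[of i] split[of j] by (elim disjE exE conjE) (simp_all add: assms(2-4) lower offdiag_simps)
  qed (simp add: out)
qed

lemma scale_half_add: "scale (of_real (1/2)) x + scale (of_real (1/2)) x = x"
  by (simp add: E.scale_left_distrib[symmetric] of_real_add[symmetric] del: of_real_divide)

text \<open>\<open>[0 x; x 0] = a\<^sup>* x a - b\<^sup>* x b\<close> for \<open>a = [I I] / \<surd>2\<close> and \<open>b = [I -I] / \<surd>2\<close>.\<close>
lemma norm_sa_offdiag_le:
  assumes n: "n > 0" and x: "x \<in> msa st n"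
  shows "norm_sa (2*n) (offdiag st n x) \<le> norm_sa n x"
proof -
  define s :: 'f where "s = of_real (sqrt (1/2))"
  have ss: "sconj s = s" "s * s = of_real (1/2)"
    unfolding s_def by (simp, subst of_real_mult[symmetric], simp)
  have ns: "(norm s)\<^sup>2 = 1/2" unfolding s_def norm_of_real by simp
  define \<tau> where "\<tau> = (\<lambda>i. if i < n then i else i - n)"
  have \<tau>: "\<tau> i < n" if "i < 2 * n" for i using that by (auto simp: \<tau>_def)
  define a where "a = selection (2*n) (\<lambda>_. s) \<tau>"
  define b where "b = selection (2*n) (\<lambda>i. if i < n then s else - s) \<tau>"
  have mva: "mv (2*n) a v k = s * (v k + v (n + k))" if "k < n" for v k
    using that by (simp add: mv_def a_def selection_def \<tau>_def sum_lessThan_double distrib_left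
        if_distrib[of "\<lambda>c. c * _"] cong: if_cong)
  have mvb: "mv (2*n) b v k = s * (v k - v (n + k))" if "k < n" for v k
    using that by (simp add: mv_def b_def selection_def \<tau>_def sum_lessThan_double right_diff_distrib
        if_distrib[of "\<lambda>c. c * _"] cong: if_cong)
  have "norm_sa (2*n) (madd (compress (2*n) n a x) (compress (2*n) n b (mneg x))) \<le> 1 * norm_sa n x"
  proof (rule norm_sa_compress2)
    show "a \<in> mats n (2*n)" "b \<in> mats n (2*n)"
      unfolding a_def b_def using \<tau> by (auto intro: selection_mats)
    fix v
    \<comment> \<open>The parallelogram law says that \<open>a\<^sup>* a + b\<^sup>* b = I\<close>,
      whence the constant 1.\<close>
    have "vsq n (mv (2*n) a v) + vsq n (mv (2*n) b v)
      = vsq n (\<lambda>k. s * (v k + v (n + k))) + vsq n (\<lambda>k. s * (v k - v (n + k)))"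
      using mva mvb by (intro arg_cong2[where f="(+)"] vsq_cong) auto
    also have "\<dots> = 1/2 * (vsq n (\<lambda>k. v k + v (n + k)) + vsq n (\<lambda>k. v k - v (n + k)))"
      by (simp add: vsq_scale ns)
    also have "\<dots> = vsq (2*n) v"
      by (simp only: vsq_parallelogram vsq_double) simp
    finally show "vsq n (mv (2*n) a v) + vsq n (mv (2*n) b v) \<le> 1 * vsq (2*n) v" by simp
  qed (use n x in \<open>auto simp: msa_mneg norm_sa_mneg\<close>)
  also have "madd (compress (2*n) n a x) (compress (2*n) n b (mneg x)) = offdiag st n x"
  proof -
    have "madd (compress (2*n) n a x) (compress (2*n) n b (mneg x)) i j = offdiag st n x i j" for i j
      unfolding a_def b_def madd_def
      by (subst compress_selection, erule \<tau>, subst compress_selection, erule \<tau>)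
        (auto simp: mneg_def offdiag_def \<tau>_def ss sconj_minus msa_entry[OF x] scale_half_add
          simp del: of_real_divide)
    then show ?thesis by (intro ext)
  qed
  finally show ?thesis by simp
qed

text \<open>Compression by the isometry that stacks two copies of I over the square root of 2
  averages the four blocks to (x + \<open>x\<^sup>*\<close>) / 2, which is x. Its columns have two
  nonzero entries, so it is not a selection matrix and the sums are split by hand.\<close>

lemma norm_sa_le_offdiag:
  assumes n: "n > 0" and x: "x \<in> msa st n"
  shows "norm_sa n x \<le> norm_sa (2*n) (offdiag st n x)"
proof -
  define s :: 'f where "s = of_real (sqrt (1/2))"
  have ss: "sconj s = s" "s * s = of_real (1/2)"
    unfolding s_def by (simp, subst of_real_mult[symmetric], simp)
  have ns: "(norm s)\<^sup>2 = 1/2" unfolding s_def norm_of_real by simp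
  define a where "a = (\<lambda>k i. if i < n \<and> (k = i \<or> k = n + i) then s else 0)"
  have mva: "mv n a v k = s * v k" "mv n a v (n + k) = s * v k" if "k < n" for v k
    using that by (simp_all add: mv_def a_def if_distrib[of "\<lambda>c. c * _"] sum.delta sum.delta' cong: if_cong conj_cong)
  have "norm_sa n (compress n (2*n) a (offdiag st n x)) \<le> 1 * norm_sa (2*n) (offdiag st n x)"
  proof (rule norm_sa_compress)
    show "a \<in> mats (2*n) n" by (auto simp: a_def mats_def)
    fix v
    have "vsq (2*n) (mv n a v) = vsq n (\<lambda>k. s * v k) + vsq n (\<lambda>k. s * v k)"
      unfolding vsq_double using mva by (intro arg_cong2[where f="(+)"] vsq_cong) auto
    then show "vsq (2*n) (mv n a v) \<le> 1 * vsq n v" by (simp add: vsq_scale ns)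
  qed (use n in \<open>auto simp: offdiag_msa\<close>)
  also have "compress n (2*n) a (offdiag st n x) = x"
  proof -
    have "compress n (2*n) a (offdiag st n x) i j = x i j" for i j
    proof (cases "i < n \<and> j < n")
      case True
      have 1: "(\<Sum>l<2*n. scale (c * a l j) (g l)) = scale (c * s) (g j) + scale (c * s) (g (n + j))" for c g
        using True by (simp add: sum_lessThan_double a_def if_distrib[of "\<lambda>c. scale c _"]
            if_distrib[of "\<lambda>c. _ * c"] cong: if_cong)
      have 2: "(\<Sum>k<2*n. scale (sconj (a k i) * c) (g k)) = scale (s * c) (g i) + scale (s * c) (g (n + i))" for c g
        using True by (simp add: sum_lessThan_double a_def if_distrib[of "\<lambda>c. scale c _"] ss sconj_zero
            if_distrib[of "\<lambda>c. c * _"] if_distrib[of sconj] cong: if_cong)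
      have "compress n (2*n) a (offdiag st n x) i j =
        scale (s * s) (offdiag st n x i j) + scale (s * s) (offdiag st n x (n + i) j)
        + (scale (s * s) (offdiag st n x i (n + j)) + scale (s * s) (offdiag st n x (n + i) (n + j)))"
        using True by (simp add: mmul_def ctrans_def 1 sum.distrib 2)
      also have "\<dots> = x i j"
        using True scale_half_add by (simp add: ss(2) offdiag_def msa_entry[OF x] del: of_real_divide)
      finally show ?thesis .
    next
      case False
      then show ?thesis using msa_mats[OF x] by (auto simp: mmul_def mats_def)
    qed
    then show ?thesis by (intro ext)
  qed
  finally show ?thesis by simp
qed

text \<open>The two branches in the definition of the norm agree on selfadjoint matrices. From here
  on every x is handled through its selfadjoint 2 x 2 block matrix alone.\<close>

lemma nrm_offdiag:
  assumes "n > 0" "x \<in> mats n n"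
  shows "nrm n x = norm_sa (2*n) (offdiag st n x)"
proof (cases "mstar st x = x")
  case True
  then have "x \<in> msa st n" using assms by (simp add: msa_def)
  then show ?thesis
    using assms True norm_sa_offdiag_le norm_sa_le_offdiag by (auto simp: bnorm_def intro: antisym)
qed (simp add: bnorm_def)

lemma nrm_msa: "x \<in> msa st n \<Longrightarrow> nrm n x = norm_sa n x"
  by (simp add: bnorm_def msa_def)

section \<open>Norm axioms and operator space axioms\<close>

lemma nrm_nonneg: "n > 0 \<Longrightarrow> x \<in> mats n n \<Longrightarrow> 0 \<le> nrm n x"
  by (simp add: nrm_offdiag norm_sa_nonneg offdiag_msa)

lemma nrm_zero: "n > 0 \<Longrightarrow> nrm n mzero = 0"
  using nrm_msa[of mzero n] by (simp add: norm_sa_zero)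

lemma nrm_eq_zero_iff:
  assumes "n > 0" "x \<in> mats n n"
  shows "nrm n x = 0 \<longleftrightarrow> x = mzero"
proof
  assume "nrm n x = 0"
  then have "offdiag st n x = mzero"
    using assms by (intro norm_sa_eq_zero[of "2*n"]) (auto simp: nrm_offdiag offdiag_msa)
  then have "x i j = 0" for i j
  proof (cases "i < n \<and> j < n")
    case True
    have "offdiag st n x i (n + j) = 0" using \<open>offdiag st n x = mzero\<close> by (simp add: mzero_def)
    then show ?thesis using True by (simp add: offdiag_def)
  qed (use assms in \<open>auto simp: mats_def\<close>)
  then show "x = mzero" by (simp add: mzero_def fun_eq_iff)
qed (simp add: nrm_zero assms)

lemma nrm_triangle:
  assumes "n > 0" "x \<in> mats n n" "y \<in> mats n n"
  shows "nrm n (madd x y) \<le> nrm n x + nrm n y"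
proof -
  have "offdiag st n (madd x y) = madd (offdiag st n x) (offdiag st n y)"
    by (auto simp: offdiag_def madd_def st_add fun_eq_iff)
  then show ?thesis using assms
    by (simp add: nrm_offdiag norm_sa_triangle offdiag_msa)
qed

text \<open>\<open>[0 axb; (axb)\<^sup>* 0] = T\<^sup>* [0 x; x\<^sup>* 0] T\<close> for \<open>T = diag (s a\<^sup>*, b / s)\<close>; the free parameter \<open>s\<close> is used to
  balance \<open>\<parallel>a\<parallel>\<close> against \<open>\<parallel>b\<parallel>\<close>.\<close>
lemma nrm_mmul_scaled_le:
  fixes s :: real
  assumes pos: "n > 0" "m > 0" "s > 0" and a: "a \<in> mats m n" and x: "x \<in> mats n n" and b: "b \<in> mats n m"
    and c: "s\<^sup>2 * (mnorm m n a)\<^sup>2 \<le> c" "(mnorm n m b)\<^sup>2 / s\<^sup>2 \<le> c"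
  shows "nrm m (mmul scale m n m a x b) \<le> c * nrm n x"
proof -
  define T where "T = (\<lambda>k i. if k < n \<and> i < m then of_real s * ctrans a k i
    else if n \<le> k \<and> m \<le> i then of_real (1/s) * b (k - n) (i - m) else 0)"
  have T: "T \<in> mats (2*n) (2*m)"
  proof -
    have "T k i = 0" if "2 * n \<le> k \<or> 2 * m \<le> i" for k i
    proof -
      have "n \<le> k - n \<or> m \<le> i - m" using that by linarith
      then show ?thesis using that mats_zero[OF b, of "k - n" "i - m"] by (auto simp: T_def)
    qed
    then show ?thesis unfolding mats_def by (simp add: not_less)
  qed
  have c0: "c \<ge> 0" using c(1) by (meson order_trans mult_nonneg_nonneg zero_le_power2)
  have mv1: "mv (2*m) T v k = of_real s * mv m (ctrans a) v k"
    and mv2: "mv (2*m) T v (n + k) = of_real (1/s) * mv m b (\<lambda>i. v (m + i)) k" if "k < n" for v k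
    using that by (simp_all add: mv_def T_def sum_lessThan_double sum_distrib_left mult.assoc del: of_real_divide)
  have "norm_sa (2*m) (compress (2*m) (2*n) T (offdiag st n x)) \<le> c * norm_sa (2*n) (offdiag st n x)"
  proof (rule norm_sa_compress)
    fix v
    have "vsq (2*n) (mv (2*m) T v) = vsq n (\<lambda>k. of_real s * mv m (ctrans a) v k)
      + vsq n (\<lambda>k. of_real (1/s) * mv m b (\<lambda>i. v (m + i)) k)"
      unfolding vsq_double using mv1 mv2 by (intro arg_cong2[where f="(+)"] vsq_cong) auto
    also have "\<dots> = s\<^sup>2 * vsq n (mv m (ctrans a) v) + vsq n (mv m b (\<lambda>i. v (m + i))) / s\<^sup>2"
      by (simp add: vsq_scale power_divide del: of_real_divide)
    also have "\<dots> \<le> s\<^sup>2 * ((mnorm m n a)\<^sup>2 * vsq m v) + (mnorm n m b)\<^sup>2 * vsq m (\<lambda>i. v (m + i)) / s\<^sup>2"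
    proof (intro add_mono mult_left_mono divide_right_mono vsq_mv_le)
      have "vsq n (mv m (ctrans a) v) \<le> (mnorm n m (ctrans a))\<^sup>2 * vsq m v" by (rule vsq_mv_le)
      also have "\<dots> \<le> (mnorm m n a)\<^sup>2 * vsq m v"
        by (intro mult_right_mono power_mono mnorm_ctrans_le) auto
      finally show "vsq n (mv m (ctrans a) v) \<le> (mnorm m n a)\<^sup>2 * vsq m v" .
    qed auto
    also have "\<dots> = (s\<^sup>2 * (mnorm m n a)\<^sup>2) * vsq m v + ((mnorm n m b)\<^sup>2 / s\<^sup>2) * vsq m (\<lambda>i. v (m + i))"
      by simp
    also have "\<dots> \<le> c * vsq m v + c * vsq m (\<lambda>i. v (m + i))"
      by (intro add_mono mult_right_mono c) auto
    finally show "vsq (2*n) (mv (2*m) T v) \<le> c * vsq (2*m) v"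
      by (simp add: vsq_double distrib_left)
  qed (use pos T c0 in \<open>auto simp: offdiag_msa\<close>)
  also have "compress (2*m) (2*n) T (offdiag st n x) = offdiag st m (mmul scale m n m a x b)"
  proof -
    let ?X = "compress (2*m) (2*n) T (offdiag st n x)"
    have X: "?X p q = (\<Sum>k<n. \<Sum>l<n. scale (sconj (T k p) * T (n + l) q) (x k l))
      + (\<Sum>k<n. \<Sum>l<n. scale (sconj (T (n + k) p) * T l q) (st (x l k)))" if "p < 2*m" "q < 2*m" for p q
      using that by (simp add: mmul_def ctrans_def sum_lessThan_double offdiag_simps)
    have T1: "T k i = of_real s * sconj (a i k)" "T k (m + i) = 0" "T (n + k) i = 0"
      "T (n + k) (m + i) = of_real (1/s) * b k i" if "k < n" "i < m" for k i
      using that by (simp_all add: T_def ctrans_def)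
    \<comment> \<open>The factors s and 1/s cancel in the corner, so the product is independent of
      the balancing parameter.\<close>
    have TT: "sconj (T k i) * T (n + l) (m + j) = a i k * b l j" if "k < n" "l < n" "i < m" "j < m" for k l i j
      using that pos by (simp add: T1 sconj_times)
    show ?thesis
    proof (rule offdiag_eqI)
      show "?X \<in> msa st (2*m)" by (intro msa_compress offdiag_msa)
      fix i j assume ij: "i < m" "j < m"
      then have b: "i < 2*m" "j < 2*m" "m + i < 2*m" "m + j < 2*m" by auto
      show "?X i j = 0" "?X (m + i) (m + j) = 0"
        unfolding X[OF b(1,2)] X[OF b(3,4)] using ij by (simp_all add: T1 sconj_zero)
      have "?X i (m + j) = (\<Sum>k<n. \<Sum>l<n. scale (a i k * b l j) (x k l))"
        unfolding X[OF b(1,4)] using ij by (simp add: TT) (simp add: T1)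
      then show "?X i (m + j) = mmul scale m n m a x b i j" using ij by (simp add: mmul_def)
    qed
  qed
  finally show ?thesis using pos x by (simp add: nrm_offdiag)
qed

lemma nrm_mmul_le:
  assumes pos: "n > 0" "m > 0" and a: "a \<in> mats m n" and x: "x \<in> mats n n" and b: "b \<in> mats n m"
  shows "nrm m (mmul scale m n m a x b) \<le> mnorm m n a * nrm n x * mnorm n m b"
proof (cases "mnorm m n a = 0 \<or> mnorm n m b = 0")
  case True
  then have "a = mzero \<or> b = mzero" using mnorm_zero_imp a b by blast
  then have "mmul scale m n m a x b = mzero" by (auto simp: mmul_def mzero_def fun_eq_iff)
  then show ?thesis using pos nrm_nonneg[OF pos(1) x] by (simp add: nrm_zero)
next
  case False
  define \<alpha> where "\<alpha> = mnorm m n a"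
  define \<beta> where "\<beta> = mnorm n m b"
  have ab: "\<alpha> > 0" "\<beta> > 0" using False by (auto simp: \<alpha>_def \<beta>_def less_le)
  \<comment> \<open>With this s both quantities to be bounded,
    \<open>s\<^sup>2 \<alpha>\<^sup>2\<close> and \<open>\<beta>\<^sup>2 / s\<^sup>2\<close>, equal
    \<alpha>\<beta>.\<close>
  define s where "s = sqrt (\<beta> / \<alpha>)"
  have s: "s > 0" "s\<^sup>2 = \<beta> / \<alpha>" using ab by (simp_all add: s_def)
  have "nrm m (mmul scale m n m a x b) \<le> (\<alpha> * \<beta>) * nrm n x"
    using ab s(1) by (intro nrm_mmul_scaled_le[OF pos s(1) a x b])
      (simp_all add: s \<alpha>_def[symmetric] \<beta>_def[symmetric], simp_all add: power2_eq_square)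
  then show ?thesis by (simp add: \<alpha>_def \<beta>_def algebra_simps)
qed

text \<open>A non-real scalar destroys selfadjointness, so decompositions of x cannot simply be
  rescaled. Multiplication by c is instead left multiplication by cI, a case of the bimodule
  inequality.\<close>

lemma nrm_mscale_le:
  assumes n: "n > 0" and x: "x \<in> mats n n"
  shows "nrm n (mscale scale c x) \<le> norm c * nrm n x"
proof -
  let ?a = "\<lambda>i j. c * idm n i j"
  have "mnorm n n ?a \<le> norm c"
  proof (rule mnorm_le)
    fix v
    have "mv n ?a v = (\<lambda>i. c * mv n (idm n) v i)" by (simp add: mv_def sum_distrib_left mult.assoc)
    then have "vsq n (mv n ?a v) = (norm c)\<^sup>2 * vsq n (mv n (idm n) v)" by (simp add: vsq_scale)
    also have "vsq n (mv n (idm n) v) = vsq n v"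
      by (rule vsq_cong) (simp add: mv_def idm_def if_distrib[of "\<lambda>c. c * _"] cong: if_cong)
    finally show "vsq n (mv n ?a v) \<le> (norm c)\<^sup>2 * vsq n v" by simp
  qed simp
  moreover have "mscale scale c x = mmul scale n n n ?a x (idm n)"
  proof -
    have "mmul scale n n n ?a x (idm n) = mscale scale c (mmul scale n n n (idm n) x (idm n))"
      by (auto simp: mmul_def mscale_def fun_eq_iff E.scale_sum_right mult.assoc)
    then show ?thesis using x by (simp add: mmul_idm)
  qed
  moreover have "nrm n (mmul scale n n n ?a x (idm n)) \<le> mnorm n n ?a * nrm n x * mnorm n n (idm n :: nat \<Rightarrow> nat \<Rightarrow> 'f)"
    using n x by (intro nrm_mmul_le) (auto simp: mats_def idm_def)
  moreover have "mnorm n n ?a * nrm n x * mnorm n n (idm n :: nat \<Rightarrow> nat \<Rightarrow> 'f) \<le> norm c * nrm n x * 1"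
    using calculation(1) mnorm_idm_le nrm_nonneg[OF n x] by (intro mult_mono) auto
  ultimately show ?thesis by simp
qed

lemma mscale_mats: "x \<in> mats n m \<Longrightarrow> mscale scale c x \<in> mats n m"
  by (simp add: mats_def mscale_def)

lemma nrm_mscale:
  assumes n: "n > 0" and x: "x \<in> mats n n"
  shows "nrm n (mscale scale c x) = norm c * nrm n x"
proof (cases "c = 0")
  case True
  then have "mscale scale c x = mzero" by (simp add: mscale_def mzero_def)
  then show ?thesis using True n by (simp add: nrm_zero)
next
  case False
  have "x = mscale scale (inverse c) (mscale scale c x)" using False by (simp add: mscale_def)
  then have "nrm n x \<le> norm (inverse c) * nrm n (mscale scale c x)"
    using nrm_mscale_le[OF n mscale_mats[OF x], of "inverse c" c] by simp
  then have "norm c * nrm n x \<le> norm c * (norm (inverse c) * nrm n (mscale scale c x))"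
    by (rule mult_left_mono) simp
  also have "\<dots> = norm (c * inverse c) * nrm n (mscale scale c x)" by (simp only: norm_mult mult.assoc)
  also have "\<dots> = nrm n (mscale scale c x)" using False by simp
  finally have "norm c * nrm n x \<le> nrm n (mscale scale c x)" .
  then show ?thesis using nrm_mscale_le[OF n x] by (intro antisym)
qed

text \<open>Exchanging the two halves of the index set turns the block matrix of x into that of its
  adjoint, and a permutation is an isometry.\<close>

lemma nrm_mstar_le:
  assumes n: "n > 0" and x: "x \<in> mats n n"
  shows "nrm n (mstar st x) \<le> nrm n x"
proof -
  define \<tau> where "\<tau> = (\<lambda>i. if i < n then n + i else i - n)"
  have \<tau>: "\<tau> i < 2 * n" if "i < 2 * n" for i using that by (auto simp: \<tau>_def)
  have inj: "inj_on \<tau> {..<2*n}" by (auto simp: inj_on_def \<tau>_def split: if_splits)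
  have "norm_sa (2*n) (compress (2*n) (2*n) (selection (2*n) (\<lambda>_. 1) \<tau>) (offdiag st n x)) \<le> 1 * norm_sa (2*n) (offdiag st n x)"
    using n by (intro norm_sa_compress vsq_selection_le selection_mats offdiag_msa \<tau> inj) auto
  also have "compress (2*n) (2*n) (selection (2*n) (\<lambda>_. 1) \<tau>) (offdiag st n x) = offdiag st n (mstar st x)"
    by (subst compress_selection, erule \<tau>) (auto simp: fun_eq_iff offdiag_def \<tau>_def mstar_def)
  moreover have "mstar st x \<in> mats n n" using x by (auto simp: mats_def mstar_def)
  ultimately show ?thesis using n x by (simp add: nrm_offdiag)
qed

lemma nrm_mstar:
  assumes n: "n > 0" and x: "x \<in> mats n n"
  shows "nrm n (mstar st x) = nrm n x"
proof -
  have "mstar st (mstar st x) = x" by (simp add: mstar_def)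
  moreover have "mstar st x \<in> mats n n" using x by (auto simp: mats_def mstar_def)
  ultimately show ?thesis using nrm_mstar_le[OF n, of "mstar st x"] nrm_mstar_le[OF n x] by simp
qed

text \<open>Up to a permutation, the block matrix of a direct sum is the direct sum of the two block
  matrices. The two selection matrices keep complementary sets of coordinates, so their squared
  norms add up to that of v and the constant is 1.\<close>

lemma nrm_dsum_le:
  assumes pos: "n > 0" "m > 0" and x: "x \<in> mats n n" and y: "y \<in> mats m m"
  shows "nrm (n + m) (dsum n x y) \<le> max (nrm n x) (nrm m y)"
proof -
  let ?p = "2 * (n + m)"
  \<comment> \<open>\<open>r i\<close> is the position within its half, and \<open>P\<close> marks
    the positions that belong to x. The value 0 of \<tau> and \<rho> elsewhere is a dummy: it is in
    range because n and m are positive, and it has weight 0.\<close>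
  define r where "r = (\<lambda>i. if i < n + m then i else i - (n + m))"
  define P where "P = (\<lambda>i. r i < n)"
  define \<tau> where "\<tau> = (\<lambda>i. if \<not> P i then 0 else if i < n + m then i else n + r i)"
  define \<rho> where "\<rho> = (\<lambda>i. if P i then 0 else if i < n + m then i - n else m + (r i - n))"
  have \<tau>: "\<tau> i < 2 * n" if "i < ?p" for i using that pos by (auto simp: \<tau>_def P_def r_def)
  have \<rho>: "\<rho> i < 2 * m" if "i < ?p" for i using that pos by (auto simp: \<rho>_def P_def r_def)
  have inj: "inj_on \<tau> {i. i < ?p \<and> P i}" "inj_on \<rho> {i. i < ?p \<and> \<not> P i}"
    by (auto simp: inj_on_def \<tau>_def \<rho>_def P_def r_def split: if_splits)
  let ?a = "selection ?p (\<lambda>i. if P i then 1 else 0) \<tau>" and ?b = "selection ?p (\<lambda>i. if \<not> P i then 1 else 0) \<rho>"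
  have "norm_sa ?p (madd (compress ?p (2*n) ?a (offdiag st n x)) (compress ?p (2*m) ?b (offdiag st m y)))
    \<le> 1 * max (nrm n x) (nrm m y)"
  proof (rule norm_sa_compress2)
    show "?a \<in> mats (2*n) ?p" "?b \<in> mats (2*m) ?p" using \<tau> \<rho> by (auto intro!: selection_mats)
    fix v :: "nat \<Rightarrow> 'f"
    show "vsq (2*n) (mv ?p ?a v) + vsq (2*m) (mv ?p ?b v) \<le> 1 * vsq ?p v"
      by (subst vsq_selection[OF _ inj(1)], erule \<tau>, subst vsq_selection[OF _ inj(2)], erule \<rho>)
        (auto simp: vsq_def sum.distrib[symmetric] intro!: sum_mono)
  qed (use pos x y in \<open>auto simp: offdiag_msa nrm_offdiag[symmetric]\<close>)
  also have "madd (compress ?p (2*n) ?a (offdiag st n x)) (compress ?p (2*m) ?b (offdiag st m y))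
    = offdiag st (n + m) (dsum n x y)"
  proof -
    let ?X = "madd (compress ?p (2*n) ?a (offdiag st n x)) (compress ?p (2*m) ?b (offdiag st m y))"
    have X: "?X i j = (if P i \<and> P j then offdiag st n x (\<tau> i) (\<tau> j) else 0)
      + (if \<not> P i \<and> \<not> P j then offdiag st m y (\<rho> i) (\<rho> j) else 0)" if "i < ?p" "j < ?p" for i j
      unfolding madd_def
      by (subst compress_selection, erule \<tau>, subst compress_selection, erule \<rho>) (use that in \<open>simp add: sconj_zero\<close>)
    have low: "P i \<longleftrightarrow> i < n" "P i \<Longrightarrow> \<tau> i = i" "\<not> P i \<Longrightarrow> \<rho> i = i - n"
      and high: "P (n + m + i) \<longleftrightarrow> i < n" "P (n + m + i) \<Longrightarrow> \<tau> (n + m + i) = n + i"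
        "\<not> P (n + m + i) \<Longrightarrow> \<rho> (n + m + i) = m + (i - n)" if "i < n + m" for i
      using that by (auto simp: P_def r_def \<tau>_def \<rho>_def)
    show ?thesis
    proof (rule offdiag_eqI)
      show "?X \<in> msa st ?p" by (intro msa_madd msa_compress offdiag_msa)
      fix i j assume ij: "i < n + m" "j < n + m"
      then have b: "i < ?p" "j < ?p" "n + m + i < ?p" "n + m + j < ?p"
        "i - n < m \<or> i < n" "j - n < m \<or> j < n" by auto
      show "?X i j = 0" "?X i (n + m + j) = dsum n x y i j" "?X (n + m + i) (n + m + j) = 0"
        unfolding X[OF b(1,2)] X[OF b(1,4)] X[OF b(3,4)] using b(5,6)
        by (auto simp: low[OF ij(1)] low[OF ij(2)] high[OF ij(1)] high[OF ij(2)] offdiag_simps dsum_def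
            simp del: Nat.add_diff_assoc)
    qed
  qed
  finally show ?thesis using pos dsum_mats[OF x y] by (simp add: nrm_offdiag)
qed

lemma nrm_le_dsum:
  assumes pos: "n > 0" "m > 0" and x: "x \<in> mats n n" and y: "y \<in> mats m m"
  shows "nrm n x \<le> nrm (n + m) (dsum n x y)" "nrm m y \<le> nrm (n + m) (dsum n x y)"
proof -
  let ?p = "2 * (n + m)" and ?D = "offdiag st (n + m) (dsum n x y)"
  \<comment> \<open>The second half of the large index set starts at n + m instead of n, hence the
    shift by m.\<close>
  define \<tau> where "\<tau> = (\<lambda>i. if i < n then i else i + m)"
  have \<tau>: "\<tau> i < ?p" if "i < 2 * n" for i using that by (auto simp: \<tau>_def)
  have inj: "inj_on \<tau> {..<2*n}" by (auto simp: inj_on_def \<tau>_def split: if_splits)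
  have "norm_sa (2*n) (compress (2*n) ?p (selection (2*n) (\<lambda>_. 1) \<tau>) ?D) \<le> 1 * norm_sa ?p ?D"
    using pos by (intro norm_sa_compress vsq_selection_le selection_mats offdiag_msa \<tau> inj) auto
  also have "compress (2*n) ?p (selection (2*n) (\<lambda>_. 1) \<tau>) ?D = offdiag st n x"
    by (subst compress_selection, erule \<tau>) (auto simp: fun_eq_iff offdiag_def \<tau>_def dsum_def)
  finally show "nrm n x \<le> nrm (n + m) (dsum n x y)"
    using pos x dsum_mats[OF x y] by (simp add: nrm_offdiag)
  \<comment> \<open>In each half the indices of y follow those of x: index m + i goes to (n + m) + n
    + i, which is a shift by 2n.\<close>
  define \<rho> where "\<rho> = (\<lambda>i. if i < m then n + i else 2 * n + i)"
  have \<rho>: "\<rho> i < ?p" if "i < 2 * m" for i using that by (auto simp: \<rho>_def)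
  have inj: "inj_on \<rho> {..<2*m}" by (auto simp: inj_on_def \<rho>_def split: if_splits)
  have "norm_sa (2*m) (compress (2*m) ?p (selection (2*m) (\<lambda>_. 1) \<rho>) ?D) \<le> 1 * norm_sa ?p ?D"
    using pos by (intro norm_sa_compress vsq_selection_le selection_mats offdiag_msa \<rho> inj) auto
  also have "compress (2*m) ?p (selection (2*m) (\<lambda>_. 1) \<rho>) ?D = offdiag st m y"
    by (subst compress_selection, erule \<rho>) (auto simp: fun_eq_iff offdiag_def \<rho>_def dsum_def)
  finally show "nrm m y \<le> nrm (n + m) (dsum n x y)"
    using pos y dsum_mats[OF x y] by (simp add: nrm_offdiag)
qed

section \<open>Contractivity of the base function and norms of positive elements\<close>

lemma mnorm_fmap_le_norm_sa:
  assumes n: "n > 0" and x: "x \<in> msa st n"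
  shows "mnorm n n (fmap f1 x) \<le> norm_sa n x"
proof (rule field_le_epsilon)
  fix e :: real assume e: "e > 0"
  obtain y z where yz: "y \<in> C n" "z \<in> C n" "x = msub y z"
    "\<And>v. re_part (sform n n v (fmap f1 (madd y z)) v) \<le> (norm_sa n x + e) * vsq n v"
    using norm_sa_less[OF n x, of "norm_sa n x + e"] e by auto
  show "mnorm n n (fmap f1 x) \<le> norm_sa n x + e"
  proof (rule hermitian_mnorm_le)
    show "0 \<le> norm_sa n x + e" using e norm_sa_nonneg[OF n x] by simp
    show "ctrans (fmap f1 x) = fmap f1 x" using x by (rule ctrans_fmap)
    fix v
    show "\<bar>re_part (sform n n v (fmap f1 x) v)\<bar> \<le> (norm_sa n x + e) * vsq n v"
      \<comment> \<open>For nonnegative p and q, the difference p - q lies between -(p + q) and p +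
        q.\<close>
      using yz(4)[of v] sform_fmap_nonneg[OF n yz(1), of v] sform_fmap_nonneg[OF n yz(2), of v]
      unfolding yz(3) fmap_madd fmap_msub sform_madd sform_msub re_part_add re_part_diff by linarith
  qed
qed

text \<open>The image of x under \<open>f1\<close> is the upper right corner of the image of its
  block matrix, and a corner has no larger norm.\<close>

lemma mnorm_fmap_le_nrm:
  assumes n: "n > 0" and x: "x \<in> mats n n"
  shows "mnorm n n (fmap f1 x) \<le> nrm n x"
proof -
  have "mnorm n n (fmap f1 x) = mnorm n n (\<lambda>i j. fmap f1 (offdiag st n x) i (n + j))"
    by (rule mnorm_cong) (simp add: fmap_def offdiag_def)
  also have "\<dots> \<le> mnorm (2*n) (2*n) (fmap f1 (offdiag st n x))" by (rule mnorm_corner_le)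
  also have "\<dots> \<le> norm_sa (2*n) (offdiag st n x)"
    using n by (intro mnorm_fmap_le_norm_sa offdiag_msa) simp
  finally show ?thesis using n x by (simp add: nrm_offdiag)
qed

text \<open>The decomposition x = x - 0 gives the upper bound; contractivity of \<open>f1\<close>
  shows that no other decomposition does better.\<close>

lemma nrm_C:
  assumes n: "n > 0" and x: "x \<in> C n"
  shows "nrm n x = mnorm n n (fmap f1 x)"
proof (rule antisym)
  have "norm_sa n x \<le> mnorm n n (fmap f1 x)"
  proof (rule norm_sa_le[OF n x C_zero[OF n]])
    fix v
    show "re_part (sform n n v (fmap f1 (madd x mzero)) v) \<le> mnorm n n (fmap f1 x) * vsq n v"
      using diag_form_le_mnorm[of n v "fmap f1 x"] by (simp add: madd_def mzero_def)
  qed (simp_all add: msub_def mzero_def)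
  then show "nrm n x \<le> mnorm n n (fmap f1 x)" using C_msa[OF n x] by (simp add: nrm_msa)
  show "mnorm n n (fmap f1 x) \<le> nrm n x"
    using n C_msa[OF n x] by (intro mnorm_fmap_le_nrm) (auto simp: msa_mats)
qed

section \<open>Decomposition of the unit ball\<close>

lemma C_factor:
  assumes n: "n > 0" and y: "y \<in> C n" and d: "\<delta> > 0"
    and pos: "\<And>v. \<delta> * vsq n v \<le> re_part (sform n n v (fmap f1 y) v)"
  shows "\<exists>c k. psd n c \<and> k \<in> K n \<and> smul n n n c c = fmap f1 y \<and> y = mmul scale n n n c k c"
proof -
  have ym: "y \<in> msa st n" using n y by (rule C_msa)
  obtain c d where c: "psd n c" "smul n n n c c = fmap f1 y" and d: "d \<in> mats n n" "ctrans d = d"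
    "smul n n n c d = idm n" "smul n n n d c = idm n"
    using positive_definite_sqrt[OF fmap_mats[OF msa_mats[OF ym]] ctrans_fmap[OF ym] d pos] by blast
  have cm: "c \<in> mats n n" using c by (simp add: psd_def)
  define k where "k = mmul scale n n n d y d"
  have "k \<in> C n" using C_compress[OF n n d(1) y] by (simp add: k_def d)
  moreover have "fmap f1 k = idm n"
  proof -
    have "fmap f1 k = smul n n n d (smul n n n (smul n n n c c) d)" by (simp add: k_def fmap_mmul c)
    also have "\<dots> = smul n n n (smul n n n d c) (smul n n n c d)" by (simp add: smul_assoc)
    also have "\<dots> = idm n" by (simp add: d smul_idm_left)
    finally show ?thesis .
  qed
  ultimately have "k \<in> K n" using n by (simp add: K_iff)
  moreover have "y = mmul scale n n n c k c"
    using mmul_idm[OF msa_mats[OF ym]] by (simp add: k_def mmul_mmul d)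
  ultimately show ?thesis using c by blast
qed

lemma unit_ball_decomposition:
  assumes n: "n > 0" and t: "t > 1" and x: "x \<in> msa st n" and N: "nrm n x \<le> 1"
  shows "\<exists>c1 c2 x1 x2. psd n c1 \<and> psd n c2 \<and>
     psd n (\<lambda>i j. of_real t * idm n i j - smul n n n c1 c1 i j - smul n n n c2 c2 i j) \<and>
     x1 \<in> K n \<and> x2 \<in> K n \<and>
     x = msub (mmul scale n n n c1 x1 c1) (mmul scale n n n c2 x2 c2)"
proof -
  \<comment> \<open>Budget for t = 1 + 4\<epsilon>: 2\<epsilon> to get strictly above the norm, and
    \<epsilon> for each of the perturbations of y and z.\<close>
  define \<epsilon> where "\<epsilon> = (t - 1) / 4"
  have e: "\<epsilon> > 0" using t by (simp add: \<epsilon>_def)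
  have "norm_sa n x < 1 + 2 * \<epsilon>" using N x e by (simp add: nrm_msa)
  then obtain y z where yz: "y \<in> C n" "z \<in> C n" "x = msub y z"
    "\<And>v. re_part (sform n n v (fmap f1 (madd y z)) v) \<le> (1 + 2 * \<epsilon>) * vsq n v"
    using norm_sa_less[OF n x] by blast
  obtain k where k: "k \<in> K n" using K_nonempty[OF n] by blast
  let ?k = "mscale scale (of_real \<epsilon>) k"
  \<comment> \<open>The same term is added to y and to z, so their difference is unchanged, while
    each image under \<open>f1\<close> increases by \<epsilon>I and becomes positive
    definite.\<close>
  define y' where "y' = madd y ?k"
  define z' where "z' = madd z ?k"
  have kC: "?k \<in> C n" using n k e by (intro C_scale) (auto simp: K_iff)
  have C': "y' \<in> C n" "z' \<in> C n" using n yz kC by (auto simp: y'_def z'_def intro: C_add)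
  have form: "re_part (sform n n v (fmap f1 y') v) = re_part (sform n n v (fmap f1 y) v) + \<epsilon> * vsq n v"
    "re_part (sform n n v (fmap f1 z') v) = re_part (sform n n v (fmap f1 z) v) + \<epsilon> * vsq n v" for v
    using k n by (simp_all add: y'_def z'_def fmap_madd fmap_mscale sform_madd sform_scaled K_iff re_part_add
        re_part_of_real_mult re_sform_idm)
  obtain c1 x1 where 1: "psd n c1" "x1 \<in> K n" "smul n n n c1 c1 = fmap f1 y'" "y' = mmul scale n n n c1 x1 c1"
    using C_factor[OF n C'(1) e] form(1) sform_fmap_nonneg[OF n yz(1)] by auto
  obtain c2 x2 where 2: "psd n c2" "x2 \<in> K n" "smul n n n c2 c2 = fmap f1 z'" "z' = mmul scale n n n c2 x2 c2"
    using C_factor[OF n C'(2) e] form(2) sform_fmap_nonneg[OF n yz(2)] by auto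
  have eq: "(\<lambda>i j. of_real t * idm n i j - smul n n n c1 c1 i j - smul n n n c2 c2 i j)
    = msub (msub (\<lambda>i j. of_real t * idm n i j) (fmap f1 y')) (fmap f1 z')"
    by (simp add: 1(3) 2(3) msub_def)
  have "psd n (\<lambda>i j. of_real t * idm n i j - smul n n n c1 c1 i j - smul n n n c2 c2 i j)"
    unfolding eq
  proof (rule psdI)
    show "msub (msub (\<lambda>i j. of_real t * idm n i j) (fmap f1 y')) (fmap f1 z') \<in> mats n n"
      using n C' by (intro msub_mats fmap_mats msa_mats C_msa) (auto simp: mats_def idm_def)
    show "ctrans (msub (msub (\<lambda>i j. of_real t * idm n i j) (fmap f1 y')) (fmap f1 z'))
      = msub (msub (\<lambda>i j. of_real t * idm n i j) (fmap f1 y')) (fmap f1 z')"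
      using n C' C_msa by (simp add: ctrans_msub ctrans_scaled ctrans_fmap[of _ n])
    fix v
    have "re_part (sform n n v (fmap f1 y') v) + re_part (sform n n v (fmap f1 z') v) \<le> (1 + 4 * \<epsilon>) * vsq n v"
      using yz(4)[of v] unfolding form by (simp add: fmap_madd sform_madd re_part_add algebra_simps)
    also have "1 + 4 * \<epsilon> = t" by (simp add: \<epsilon>_def field_simps)
    finally show "0 \<le> re_part (sform n n v (msub (msub (\<lambda>i j. of_real t * idm n i j) (fmap f1 y')) (fmap f1 z')) v)"
      by (simp add: sform_msub re_part_diff sform_scaled re_part_of_real_mult re_sform_idm)
  qed
  moreover have "x = msub y' z'" by (simp add: yz(3) y'_def z'_def msub_def madd_def)
  ultimately show ?thesis using 1(1,2) 2(1,2) unfolding 1(4) 2(4) by blast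
qed

end

text \<open>The identity for direct sums and the bimodule inequality are Ruan's axioms for an
  operator space. The description of \<open>K\<close> by \<open>f1\<close> and its matrix convexity
  are contained in \<open>matrix_base_ordered\<close> and so do not reappear in the
  conclusion.\<close>

theorem theorem4p4:
  fixes scale :: "'f::rcl_field \<Rightarrow> 'e::ab_group_add \<Rightarrow> 'e"
    and st :: "'e \<Rightarrow> 'e"
    and C K :: "nat \<Rightarrow> (nat \<Rightarrow> nat \<Rightarrow> 'e) set"
    and f1 :: "'e \<Rightarrow> 'f"
  assumes base: "matrix_base_ordered scale st C K f1"
  defines "N \<equiv> bnorm scale st f1 C"
  shows
    "(\<forall>n>0. (\<forall>x\<in>mats n n. 0 \<le> N n x \<and> (N n x = 0 \<longleftrightarrow> x = mzero)) \<and>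
       (\<forall>x\<in>mats n n. \<forall>y\<in>mats n n. N n (madd x y) \<le> N n x + N n y) \<and>
       (\<forall>c. \<forall>x\<in>mats n n. N n (mscale scale c x) = norm c * N n x))
   \<and> (\<forall>n>0. \<forall>m>0. \<forall>x\<in>mats n n. \<forall>y\<in>mats m m.
          N (n + m) (dsum n x y) = max (N n x) (N m y))
   \<and> (\<forall>n>0. \<forall>m>0. \<forall>a\<in>mats m n. \<forall>x\<in>mats n n. \<forall>b\<in>mats n m.
          N m (mmul scale m n m a x b) \<le> mnorm m n a * N n x * mnorm n m b)
   \<and> (\<forall>n>0. \<forall>x\<in>mats n n. N n (mstar st x) = N n x)
   \<and> (\<forall>n>0. \<forall>x\<in>K n. x \<in> C n \<and> N n x \<le> 1)
   \<and> (\<forall>n>0. \<forall>x\<in>mats n n. mnorm n n (fmap f1 x) \<le> N n x)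
   \<and> (\<forall>n>0. \<forall>x\<in>C n. N n x = mnorm n n (fmap f1 x))
   \<and> (\<forall>n>0. \<forall>t::real>1. \<forall>x\<in>msa st n. N n x \<le> 1 \<longrightarrow>
          (\<exists>c1 c2 x1 x2. psd n c1 \<and> psd n c2 \<and>
             psd n (\<lambda>i j. of_real t * idm n i j - smul n n n c1 c1 i j - smul n n n c2 c2 i j) \<and>
             x1 \<in> K n \<and> x2 \<in> K n \<and>
             x = msub (mmul scale n n n c1 x1 c1) (mmul scale n n n c2 x2 c2)))"
proof -
  interpret matrix_base_space scale st C K f1 using base by unfold_locales
  show ?thesis
    unfolding N_def
  proof (intro conjI allI impI ballI)
    fix n m :: nat and x y :: "nat \<Rightarrow> nat \<Rightarrow> 'e" assume "n > 0" "m > 0" "x \<in> mats n n" "y \<in> mats m m"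
    then show "bnorm scale st f1 C (n + m) (dsum n x y) = max (bnorm scale st f1 C n x) (bnorm scale st f1 C m y)"
      using nrm_dsum_le[of n m x y] nrm_le_dsum[of n m x y] by linarith
  next
    fix n :: nat and x :: "nat \<Rightarrow> nat \<Rightarrow> 'e" assume *: "n > 0" "x \<in> K n"
    then show "x \<in> C n" by (simp add: K_iff)
    \<comment> \<open>On \<open>K\<close> the image under \<open>f1\<close> is the identity matrix,
      whose norm is at most 1.\<close>
    then show "bnorm scale st f1 C n x \<le> 1" using * mnorm_idm_le by (simp add: nrm_C K_iff)
  next
    fix n :: nat and t :: real and x :: "nat \<Rightarrow> nat \<Rightarrow> 'e" assume "n > 0" "t > 1" "x \<in> msa st n" "bnorm scale st f1 C n x \<le> 1"
    then show "\<exists>c1 c2 x1 x2. psd n c1 \<and> psd n c2 \<and>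
             psd n (\<lambda>i j. of_real t * idm n i j - smul n n n c1 c1 i j - smul n n n c2 c2 i j) \<and>
             x1 \<in> K n \<and> x2 \<in> K n \<and>
             x = msub (mmul scale n n n c1 x1 c1) (mmul scale n n n c2 x2 c2)"
      by (rule unit_ball_decomposition)
  qed (auto intro: nrm_nonneg nrm_triangle nrm_mscale nrm_mmul_le nrm_mstar mnorm_fmap_le_nrm nrm_C
      nrm_eq_zero_iff[THEN iffD1] nrm_zero)
qed

end
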